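(* Let $X$ be a super-reflexive Banach space. Let $E\subset X$ and let $f$ be a real function on $E$. Then $f$ can be extended to a real function $F\in C^{1,+}_{\mathrm B}(X)$ if and only if the following condition holds: $(\widetilde{\mathrm W})$: there exists a mapping $G\colon E\to X^*$ such that for each bounded $B\subset E$ the function $f$ is bounded on $B$, the mapping $G$ is bounded and uniformly continuous on $B$, and for each $\varepsilon>0$ there exists $\delta>0$ such that $|f(y)-f(x)-\langle G(x),y-x\rangle|\le\varepsilon\|y-x\|$ whenever $x,y\in B$ and $\|y-x\|<\delta$. Moreover, if $(\widetilde{\mathrm W})$ is satisfied with a mapping $G$, then $F$ can be found such that $DF(x)=G(x)$ for each $x\in E$.
   Context: All normed linear spaces are real; $\langle g,x\rangle=g(x)$ for $g\in X^*$, $x\in X$, and $DF$ denotes the Fréchet derivative of $F$. For an open subset $U$ of a normed linear space, $C^{1,+}_{\mathrm B}(U)$ is the set of all Fréchet differentiable functions $f\colon U\to\mathbb R$ such that $Df$ is uniformly continuous on each bounded subset of $U$. A Banach space is super-reflexive if and only if it has an equivalent uniformly smooth norm. *)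

theory Defs
  imports "HOL-Analysis.Analysis"
begin

definition equivalent_norm :: "('a::real_normed_vector \<Rightarrow> real) \<Rightarrow> bool" where
  "equivalent_norm N \<longleftrightarrow>
     (\<forall>x. N x \<ge> 0) \<and> (\<forall>x. N x = 0 \<longleftrightarrow> x = 0) \<and>
     (\<forall>c x. N (c *\<^sub>R x) = \<bar>c\<bar> * N x) \<and>
     (\<forall>x y. N (x + y) \<le> N x + N y) \<and>
     (\<exists>a>0. \<exists>b>0. \<forall>x. a * norm x \<le> N x \<and> N x \<le> b * norm x)"

(* This says that the modulus of smoothness of N at t is o(t) as t tends to 0 from the right,
   written without the supremum, which would be over the empty set in the zero space. *)
definition uniformly_smooth_norm :: "('a::real_normed_vector \<Rightarrow> real) \<Rightarrow> bool" where
  "uniformly_smooth_norm N \<longleftrightarrow>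
     (\<forall>\<epsilon>>0. \<exists>\<delta>>0. \<forall>x y. N x = 1 \<longrightarrow> N y \<le> \<delta> \<longrightarrow>
        N (x + y) + N (x - y) \<le> 2 + \<epsilon> * N y)"

(* Super-reflexivity is taken in its renorming form. The definition by finite representability
   would quantify over all Banach spaces; the two agree by theorems of Enflo and Pisier. *)
definition super_reflexive :: "'a::banach itself \<Rightarrow> bool" where
  "super_reflexive (_ :: 'a itself) \<longleftrightarrow>
     (\<exists>N :: 'a \<Rightarrow> real. equivalent_norm N \<and> uniformly_smooth_norm N)"

(* The Frechet derivative as an element of the dual space with its operator norm;
   meaningful only at points where F is differentiable. *)
definition DF :: "('a::real_normed_vector \<Rightarrow> real) \<Rightarrow> 'a \<Rightarrow> ('a \<Rightarrow>\<^sub>L real)" where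
  "DF F x = Blinfun (frechet_derivative F (at x))"

(* Meant for open U; the values of F outside U are irrelevant. *)
definition C1plusB :: "'a::real_normed_vector set \<Rightarrow> ('a \<Rightarrow> real) set" where
  "C1plusB U = {F. (\<forall>x\<in>U. F differentiable (at x)) \<and>
                   (\<forall>B. B \<subseteq> U \<longrightarrow> bounded B \<longrightarrow> uniformly_continuous_on B (DF F))}"

(* Only the values of f and G on E matter. *)
definition condition_W ::
  "'a::real_normed_vector set \<Rightarrow> ('a \<Rightarrow> real) \<Rightarrow> ('a \<Rightarrow> ('a \<Rightarrow>\<^sub>L real)) \<Rightarrow> bool" where
  "condition_W E f G \<longleftrightarrow>
     (\<forall>B. B \<subseteq> E \<longrightarrow> bounded B \<longrightarrow>
        bounded (f ` B) \<and> bounded (G ` B) \<and> uniformly_continuous_on B G \<and>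
        (\<forall>\<epsilon>>0. \<exists>\<delta>>0. \<forall>x\<in>B. \<forall>y\<in>B. norm (y - x) < \<delta> \<longrightarrow>
           \<bar>f y - f x - blinfun_apply (G x) (y - x)\<bar> \<le> \<epsilon> * norm (y - x)))"

end

theory Submission
  imports Defs
begin

text \<open>
Necessity is the mean value theorem: on a ball a uniformly continuous derivative is bounded, so \<open>F\<close>
is bounded there, and the first order remainder is controlled by the oscillation of the derivative.

For sufficiency, first let the jet \<open>(f, G)\<close> satisfy the condition on a bounded set \<open>E\<close>, so that all
estimates are uniform on \<open>E\<close>. The uniformly smooth norm \<open>N\<close> yields a kernel \<open>\<Phi> \<ge> 0\<close> with
\<open>\<Phi> 0 = 0\<close> which is uniformly semiconcave,

\<open>t \<Phi>(x + (1 - t) h) + (1 - t) \<Phi>(x - t h) \<le> \<Phi>(x) + t (1 - t) o(\<parallel>h\<parallel>)\<close> uniformly in \<open>x\<close> and \<open>t\<close>,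

and which is large enough to absorb the errors of the jet (\<open>smooth_kernel\<close>): every lower cone
\<open>u y x = f y + G y (x - y) - \<Phi>(x - y)\<close> lies below every upper cone
\<open>v z x = f z + G z (x - z) + \<Phi>(x - z)\<close>. Any function between the lower and the upper cones takes the value
\<open>f y\<close> and has the derivative \<open>G y\<close> at \<open>y\<close>, because \<open>\<Phi>(x - y)\<close> is \<open>o(\<parallel>x - y\<parallel>)\<close>.

A smooth function in between comes from an argument in the spirit of Ilmanen's lemma
(\<open>semiconvex_semiconcave_insertion\<close>). Let \<open>F\<close> be the largest function below all \<open>v\<close> that is semiconvex
with the given modulus; it exists since suprema preserve semiconvexity, and it is above all \<open>u\<close>. It is also semiconcave:
the function \<open>x \<mapsto> t F(x + (1 - t) h) + (1 - t) F(x - t h) - t (1 - t) e \<parallel>h\<parallel>\<close> is an average of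
translates of \<open>F\<close>, hence semiconvex with the same modulus, and it stays below all \<open>v\<close> because these are semiconcave; by
maximality it is at most \<open>F\<close>, and this is semiconcavity. A function that is semiconvex and semiconcave with
moduli \<open>o(\<parallel>h\<parallel>)\<close> is nearly affine on short segments, uniformly in their position; its difference quotients
converge uniformly, and it has a uniformly continuous derivative
(\<open>uniform_expansion_of_semiconvex\<close>, \<open>C1plusB_of_uniform_expansion\<close>). This settles bounded \<open>E\<close>
(\<open>extension_of_jet\<close>).

For general \<open>E\<close>, build \<open>H 0, H 1, \<dots>\<close> in \<open>C1plusB UNIV\<close>, where \<open>H n\<close> extends the jet on
\<open>E \<inter> cball 0 (n + 1)\<close> and \<open>H (Suc n)\<close> agrees with \<open>H n\<close> on \<open>cball 0 n\<close>. Each step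
is an extension from a bounded set: \<open>H (Suc n)\<close> extends the jet that is given by \<open>H n\<close> on \<open>cball 0 n\<close> and by \<open>(f, G)\<close> on
\<open>E \<inter> cball 0 (n + 2)\<close>, and this is again an admissible jet on a bounded set, because two of its points at distance
less than 1 both carry the jet of \<open>H n\<close> or both carry \<open>(f, G)\<close>.
\<close>

section \<open>Functions with a modulus of semiconvexity\<close>

text \<open>
The modulus is coded by \<open>d\<close>: segments of length at most \<open>d e\<close> violate convexity by at most
\<open>e t (1 - t)\<close> times their length. It is fixed in advance, rather than hidden behind an existential quantifier, so
that whole families of functions share it. The weights \<open>t\<close> are general because the midpoint inequality with an error
\<open>o(\<parallel>h\<parallel>)\<close> is too weak: in its two-sided form it does not even give differentiability.
Semiconcavity of \<open>g\<close> is expressed as semiconvexity of \<open>- g\<close>.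
\<close>

definition semiconvex :: "(real \<Rightarrow> real) \<Rightarrow> ('a::real_normed_vector \<Rightarrow> real) \<Rightarrow> bool" where
  "semiconvex d g \<longleftrightarrow>
     (\<forall>e>0. \<forall>x h. \<forall>t\<in>{0..1}. norm h \<le> d e \<longrightarrow>
        g x \<le> t * g (x + (1 - t) *\<^sub>R h) + (1 - t) * g (x - t *\<^sub>R h) + e * t * (1 - t) * norm h)"

lemma semiconvexD:
  assumes "semiconvex d g" "0 < e" "0 \<le> t" "t \<le> 1" "norm h \<le> d e"
  shows "g x \<le> t * g (x + (1 - t) *\<^sub>R h) + (1 - t) * g (x - t *\<^sub>R h) + e * t * (1 - t) * norm h"
  using assms unfolding semiconvex_def by auto

lemma semiconvex_average:
  assumes g: "semiconvex d g" and s: "0 \<le> s" "s \<le> 1"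
  shows "semiconvex d (\<lambda>x. s * g (x + a) + (1 - s) * g (x + b) - c)"
  unfolding semiconvex_def
proof (intro allI impI ballI)
  fix e :: real and x h :: 'a and t :: real
  assume *: "0 < e" "t \<in> {0..1}" "norm h \<le> d e"
  define R where "R = e * t * (1 - t) * norm h"
  have 1: "g (x + a) \<le> t * g (x + (1 - t) *\<^sub>R h + a) + (1 - t) * g (x - t *\<^sub>R h + a) + R"
    using semiconvexD[OF g, of e t h "x + a"] * by (simp add: algebra_simps R_def)
  have 2: "g (x + b) \<le> t * g (x + (1 - t) *\<^sub>R h + b) + (1 - t) * g (x - t *\<^sub>R h + b) + R"
    using semiconvexD[OF g, of e t h "x + b"] * by (simp add: algebra_simps R_def)
  have "s * g (x + a) + (1 - s) * g (x + b) \<le>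
      s * (t * g (x + (1 - t) *\<^sub>R h + a) + (1 - t) * g (x - t *\<^sub>R h + a) + R) +
      (1 - s) * (t * g (x + (1 - t) *\<^sub>R h + b) + (1 - t) * g (x - t *\<^sub>R h + b) + R)"
    using s by (intro add_mono mult_left_mono 1 2) auto
  then show "s * g (x + a) + (1 - s) * g (x + b) - c
      \<le> t * (s * g (x + (1 - t) *\<^sub>R h + a) + (1 - s) * g (x + (1 - t) *\<^sub>R h + b) - c) +
        (1 - t) * (s * g (x - t *\<^sub>R h + a) + (1 - s) * g (x - t *\<^sub>R h + b) - c) +
        e * t * (1 - t) * norm h"
    unfolding R_def[symmetric] by (simp add: algebra_simps)
qed

text \<open>
The convexity defect is bounded below by a quantity that does not depend on the function, so it survives the
supremum; this is where the modulus has to be common to the whole family.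
\<close>

lemma semiconvex_SUP:
  assumes S: "S \<noteq> {}" "\<And>g. g \<in> S \<Longrightarrow> semiconvex d g" and bdd: "\<And>x. bdd_above ((\<lambda>g. g x) ` S)"
  shows "semiconvex d (\<lambda>x. SUP g\<in>S. g x)"
  unfolding semiconvex_def
proof (intro allI impI ballI)
  fix e :: real and x h :: 'a and t :: real
  assume *: "0 < e" "t \<in> {0..1}" "norm h \<le> d e"
  let ?F = "\<lambda>x. SUP g\<in>S. g x"
  show "?F x \<le> t * ?F (x + (1 - t) *\<^sub>R h) + (1 - t) * ?F (x - t *\<^sub>R h) + e * t * (1 - t) * norm h"
  proof (rule cSUP_least[OF S(1)])
    fix g assume g: "g \<in> S"
    have "g x \<le> t * g (x + (1 - t) *\<^sub>R h) + (1 - t) * g (x - t *\<^sub>R h) + e * t * (1 - t) * norm h"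
      using semiconvexD[OF S(2)[OF g]] * by simp
    also have "\<dots> \<le> t * ?F (x + (1 - t) *\<^sub>R h) + (1 - t) * ?F (x - t *\<^sub>R h) + e * t * (1 - t) * norm h"
      using * by (intro add_mono mult_left_mono cSUP_upper[OF g bdd]) auto
    finally show "g x \<le> \<dots>" .
  qed
qed

text \<open>
Take for \<open>F\<close> the largest function below \<open>V\<close> that is semiconvex with modulus \<open>d\<close>. Averaging translates
preserves this class, and the semiconcavity of the members of \<open>V\<close> keeps the averages below \<open>V\<close>; so the averages are
below \<open>F\<close>, which makes \<open>F\<close> semiconcave. The argument is the one by which a convex envelope inherits
smoothness from above.
\<close>

lemma semiconvex_semiconcave_insertion:
  fixes U V :: "('a::real_normed_vector \<Rightarrow> real) set"
  assumes ne: "U \<noteq> {}" "V \<noteq> {}"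
    and U: "\<And>u. u \<in> U \<Longrightarrow> semiconvex d u"
    and V: "\<And>v. v \<in> V \<Longrightarrow> semiconvex d (\<lambda>x. - v x)"
    and UV: "\<And>u v x. u \<in> U \<Longrightarrow> v \<in> V \<Longrightarrow> u x \<le> v x"
  obtains F where "semiconvex d F" "semiconvex d (\<lambda>x. - F x)"
    "\<And>u x. u \<in> U \<Longrightarrow> u x \<le> F x" "\<And>v x. v \<in> V \<Longrightarrow> F x \<le> v x"
proof -
  define S where "S = {g. semiconvex d g \<and> (\<forall>v\<in>V. \<forall>x. g x \<le> v x)}"
  define F where "F = (\<lambda>x. SUP g\<in>S. g x)"
  have US: "U \<subseteq> S" using U UV by (auto simp: S_def)
  then have S: "S \<noteq> {}" using ne by auto
  obtain v0 where "v0 \<in> V" using ne by auto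
  then have bdd: "bdd_above ((\<lambda>g. g x) ` S)" for x
    unfolding bdd_above_def by (intro exI[of _ "v0 x"]) (auto simp: S_def)
  have up: "g x \<le> F x" if "g \<in> S" for g x
    unfolding F_def by (rule cSUP_upper[OF that bdd])
  have low: "F x \<le> v x" if "v \<in> V" for v x
    unfolding F_def using that by (intro cSUP_least[OF S]) (auto simp: S_def)
  have F: "semiconvex d F"
    unfolding F_def by (rule semiconvex_SUP[OF S _ bdd]) (auto simp: S_def)
  have "semiconvex d (\<lambda>x. - F x)"
    unfolding semiconvex_def
  proof (intro allI impI ballI)
    fix e :: real and x h :: 'a and t :: real
    assume *: "0 < e" "t \<in> {0..1}" "norm h \<le> d e"
    \<comment> \<open>the candidate against which the maximality of the envelope is tested\<close>
    define g where "g = (\<lambda>x. t * F (x + (1 - t) *\<^sub>R h) + (1 - t) * F (x + (- t *\<^sub>R h))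
        - e * t * (1 - t) * norm h)"
    have "semiconvex d g"
      unfolding g_def using * by (intro semiconvex_average F) auto
    moreover have "g y \<le> v y" if v: "v \<in> V" for v y
    proof -
      have "g y \<le> t * v (y + (1 - t) *\<^sub>R h) + (1 - t) * v (y + (- t *\<^sub>R h)) - e * t * (1 - t) * norm h"
        unfolding g_def using * by (intro diff_right_mono add_mono mult_left_mono low v) auto
      also have "\<dots> \<le> v y"
        using semiconvexD[OF V[OF v], of e t h y] * by simp
      finally show ?thesis .
    qed
    ultimately have "g \<in> S" by (simp add: S_def)
    from up[OF this, of x]
    show "- F x \<le> t * - F (x + (1 - t) *\<^sub>R h) + (1 - t) * - F (x - t *\<^sub>R h) + e * t * (1 - t) * norm h"
      by (simp add: g_def)
  qed
  then show thesis
    using that[of F] F up US low by blast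
qed

section \<open>From two-sided semiconvexity to uniform differentiability\<close>

text \<open>
Directional derivatives are obtained below as limits that commute with combinations of two directions with
weights \<open>1 - t\<close> and \<open>t\<close>; together with the value 0 at 0 this already forces linearity.
\<close>

lemma linear_of_affine_combinations:
  fixes l :: "'a::real_vector \<Rightarrow> real"
  assumes zero: "l 0 = 0"
    and aff: "\<And>h k t. 0 \<le> t \<Longrightarrow> t \<le> 1 \<Longrightarrow> l ((1 - t) *\<^sub>R h + t *\<^sub>R k) = (1 - t) * l h + t * l k"
  shows "linear l"
proof -
  have small: "l (t *\<^sub>R h) = t * l h" if "0 \<le> t" "t \<le> 1" for t h
    using aff[OF that, of 0 h] zero by simp
  have nonneg: "l (c *\<^sub>R h) = c * l h" if "0 \<le> c" for c h
  proof (cases "c \<le> 1")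
    case False
    then have "l h = (1 / c) * l (c *\<^sub>R h)"
      using small[of "1 / c" "c *\<^sub>R h"] by simp
    then show ?thesis using False by simp
  qed (use small that in auto)
  have add: "l (h + k) = l h + l k" for h k
    using aff[of "1/2" h k] nonneg[of "1/2" "h + k"] by (simp add: scaleR_add_right)
  have neg: "l (- h) = - l h" for h
    using add[of h "- h"] zero by simp
  have "l (c *\<^sub>R h) = c * l h" for c h
    using nonneg[of c h] nonneg[of "- c" h] neg[of "c *\<^sub>R h"] by (cases "0 \<le> c") auto
  with add show ?thesis by (intro linearI) auto
qed

text \<open>
Both inequalities together say that \<open>F\<close> is affine up to an error \<open>o(\<parallel>h\<parallel>)\<close> on segments of length
\<open>\<parallel>h\<parallel>\<close>. Hence the difference quotients along \<open>h / 2 ^ n\<close> form a Cauchy sequence, the limit is linear in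
\<open>h\<close>, and it differs from the first quotient by at most \<open>e \<parallel>h\<parallel>\<close>. Local boundedness of \<open>F\<close> is what
makes the linear limit continuous.
\<close>

lemma uniform_expansion_of_semiconvex:
  fixes F :: "'a::real_normed_vector \<Rightarrow> real"
  assumes d: "\<And>e. 0 < e \<Longrightarrow> 0 < d e"
    and F: "semiconvex d F" "semiconvex d (\<lambda>x. - F x)"
    and bd: "\<And>r. bounded (F ` cball 0 r)"
  shows "\<exists>L :: 'a \<Rightarrow> ('a \<Rightarrow>\<^sub>L real). \<forall>e>0. \<forall>x h. norm h \<le> d e \<longrightarrow>
    \<bar>F (x + h) - F x - L x h\<bar> \<le> e * norm h"
proof -
  have aff: "\<bar>F (x + ((1 - t) *\<^sub>R h + t *\<^sub>R k)) - ((1 - t) * F (x + h) + t * F (x + k))\<bar>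
      \<le> e * t * norm (k - h)"
    if "0 < e" "0 \<le> t" "t \<le> 1" "norm (k - h) \<le> d e" for x h k e t
  proof -
    have a: "x + ((1 - t) *\<^sub>R h + t *\<^sub>R k) + (1 - t) *\<^sub>R (k - h) = x + k"
      by (simp add: algebra_simps)
    have b: "x + ((1 - t) *\<^sub>R h + t *\<^sub>R k) - t *\<^sub>R (k - h) = x + h"
      by (simp add: algebra_simps)
    have "(e * t * norm (k - h)) * (1 - t) \<le> (e * t * norm (k - h)) * 1"
      using that by (intro mult_left_mono) auto
    then have c: "e * t * (1 - t) * norm (k - h) \<le> e * t * norm (k - h)"
      by (simp add: mult_ac)
    show ?thesis
      using semiconvexD[OF F(1) that, of "x + ((1 - t) *\<^sub>R h + t *\<^sub>R k)", unfolded a b]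
        semiconvexD[OF F(2) that, of "x + ((1 - t) *\<^sub>R h + t *\<^sub>R k)", unfolded a b] c
      by simp
  qed
  \<comment> \<open>difference quotients along the dyadic step sizes\<close>
  define q where "q = (\<lambda>x h n. 2 ^ n * (F (x + (1 / 2 ^ n) *\<^sub>R h) - F x))"
  have qaff_le: "\<bar>q x ((1 - t) *\<^sub>R h + t *\<^sub>R k) n - ((1 - t) * q x h n + t * q x k n)\<bar>
      \<le> e * t * norm (k - h)"
    if e: "0 < e" and t: "0 \<le> t" "t \<le> 1" and n: "norm ((1 / 2 ^ n) *\<^sub>R (k - h)) \<le> d e"
    for x h k t e n
  proof -
    let ?s = "1 / 2 ^ n :: real"
    let ?D = "F (x + ?s *\<^sub>R ((1 - t) *\<^sub>R h + t *\<^sub>R k)) - ((1 - t) * F (x + ?s *\<^sub>R h) + t * F (x + ?s *\<^sub>R k))"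
    have 1: "(1 - t) *\<^sub>R (?s *\<^sub>R h) + t *\<^sub>R (?s *\<^sub>R k) = ?s *\<^sub>R ((1 - t) *\<^sub>R h + t *\<^sub>R k)"
      by (simp add: scaleR_add_right)
    have 2: "?s *\<^sub>R k - ?s *\<^sub>R h = ?s *\<^sub>R (k - h)" by (simp add: scaleR_diff_right)
    have "\<bar>?D\<bar> \<le> e * t * norm (?s *\<^sub>R (k - h))"
      using aff[OF e t, of "?s *\<^sub>R k" "?s *\<^sub>R h" x] n unfolding 1 2 by simp
    then have "2 ^ n * \<bar>?D\<bar> \<le> 2 ^ n * (e * t * norm (?s *\<^sub>R (k - h)))"
      by (intro mult_left_mono) auto
    moreover have "q x ((1 - t) *\<^sub>R h + t *\<^sub>R k) n - ((1 - t) * q x h n + t * q x k n) = 2 ^ n * ?D"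
      unfolding q_def by (simp add: algebra_simps)
    ultimately show ?thesis by (simp add: abs_mult)
  qed
  have small: "\<exists>n0. \<forall>n\<ge>n0. norm ((1 / 2 ^ n) *\<^sub>R h) \<le> c" if "0 < c" for h :: 'a and c
  proof -
    have "(\<lambda>n. norm h / 2 ^ n) \<longlonglongrightarrow> 0"
      by (rule LIMSEQ_divide_realpow_zero) simp
    from order_tendstoD(2)[OF this that] show ?thesis
      by (auto simp: eventually_sequentially intro: less_imp_le)
  qed
  have qdiff: "\<bar>q x h (n + m) - q x h n\<bar> \<le> e * norm h"
    if "0 < e" "norm ((1 / 2 ^ n) *\<^sub>R h) \<le> d e" for x h e n m
  proof -
    let ?k = "(1 / 2 ^ n) *\<^sub>R h" and ?t = "1 / 2 ^ m :: real"
    let ?D = "F (x + ?t *\<^sub>R ?k) - ((1 - ?t) * F x + ?t * F (x + ?k))"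
    have "\<bar>?D\<bar> \<le> e * ?t * norm ?k"
      using aff[OF that(1), of ?t ?k 0 x] that by simp
    then have "2 ^ (n + m) * \<bar>?D\<bar> \<le> 2 ^ (n + m) * (e * ?t * norm ?k)"
      by (intro mult_left_mono) auto
    also have "\<dots> = e * norm h" by (simp add: power_add)
    finally have "\<bar>2 ^ (n + m) * ?D\<bar> \<le> e * norm h" by (simp add: abs_mult)
    moreover have "q x h (n + m) - q x h n = 2 ^ (n + m) * ?D"
      unfolding q_def by (simp add: field_simps power_add)
    ultimately show ?thesis by simp
  qed
  have "convergent (q x h)" for x h
    unfolding Cauchy_convergent_iff[symmetric]
  proof (rule metric_CauchyI)
    fix r :: real assume r: "0 < r"
    define e where "e = r / (4 * (norm h + 1))"
    have pos: "0 < norm h + 1" by (simp add: add_nonneg_pos)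
    then have e: "0 < e" using r by (simp add: e_def field_simps)
    have eh: "e * norm h < r / 2"
    proof -
      have "e * norm h \<le> e * (norm h + 1)" using e by (intro mult_left_mono) auto
      also have "\<dots> = r / 4" using pos by (simp add: e_def field_simps)
      finally show ?thesis using r by simp
    qed
    obtain n where n: "norm ((1 / 2 ^ n) *\<^sub>R h) \<le> d e" using small d e by blast
    have "\<bar>q x h k - q x h n\<bar> < r / 2" if "k \<ge> n" for k
      using qdiff[OF e n, of x "k - n"] that eh by simp
    then have "dist (q x h k) (q x h l) < r" if "k \<ge> n" "l \<ge> n" for k l
      using that unfolding dist_real_def by (smt (verit) field_sum_of_halves)
    then show "\<exists>M. \<forall>m\<ge>M. \<forall>n\<ge>M. dist (q x h m) (q x h n) < r" by blast
  qed
  then obtain l where l: "\<And>x h. (q x h) \<longlonglongrightarrow> l x h"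
    unfolding convergent_def by metis
  have exp: "\<bar>F (x + h) - F x - l x h\<bar> \<le> e * norm h" if "0 < e" "norm h \<le> d e" for x h e
  proof -
    have "(\<lambda>m. \<bar>q x h m - q x h 0\<bar>) \<longlonglongrightarrow> \<bar>l x h - q x h 0\<bar>"
      by (intro tendsto_intros l)
    moreover have "\<bar>q x h m - q x h 0\<bar> \<le> e * norm h" for m
      using qdiff[of e 0 h x m] that by simp
    ultimately have "\<bar>l x h - q x h 0\<bar> \<le> e * norm h"
      by (intro LIMSEQ_le_const2) auto
    then show ?thesis by (simp add: q_def abs_minus_commute)
  qed
  have lin: "linear (l x)" for x
  proof (rule linear_of_affine_combinations)
    show "l x 0 = 0"
      using l[of x 0] by (simp add: q_def LIMSEQ_const_iff)
    fix h k and t :: real assume t: "0 \<le> t" "t \<le> 1"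
    let ?D = "\<bar>l x ((1 - t) *\<^sub>R h + t *\<^sub>R k) - ((1 - t) * l x h + t * l x k)\<bar>"
    have lim: "(\<lambda>n. \<bar>q x ((1 - t) *\<^sub>R h + t *\<^sub>R k) n - ((1 - t) * q x h n + t * q x k n)\<bar>) \<longlonglongrightarrow> ?D"
      by (intro tendsto_intros l)
    have "?D \<le> 0"
    proof (rule field_le_epsilon)
      fix r :: real assume r: "0 < r"
      define e where "e = r / (norm (k - h) + 1)"
      have pos: "0 < norm (k - h) + 1" by (simp add: add_nonneg_pos)
      then have e: "0 < e" using r by (simp add: e_def field_simps)
      have "e * t * norm (k - h) \<le> e * 1 * (norm (k - h) + 1)"
        using e t by (intro mult_mono) auto
      also have "\<dots> = r" using pos by (simp add: e_def)
      finally have er: "e * t * norm (k - h) \<le> r" .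
      obtain n0 where "\<And>n. n \<ge> n0 \<Longrightarrow> norm ((1 / 2 ^ n) *\<^sub>R (k - h)) \<le> d e"
        using small d e by blast
      then have "?D \<le> e * t * norm (k - h)"
        using qaff_le[OF e t] by (intro LIMSEQ_le_const2[OF lim]) blast
      with er show "?D \<le> 0 + r" by simp
    qed
    then show "l x ((1 - t) *\<^sub>R h + t *\<^sub>R k) = (1 - t) * l x h + t * l x k" by simp
  qed
  have bl: "bounded_linear (l x)" for x
  proof -
    define r where "r = d 1"
    have r: "0 < r" using d by (simp add: r_def)
    obtain M where M: "\<And>y. norm y \<le> norm x + r \<Longrightarrow> \<bar>F y\<bar> \<le> M"
      using bd[of "norm x + r"] unfolding bounded_iff by (fastforce simp: image_iff)
    have ball: "\<bar>l x h\<bar> \<le> 2 * M + r" if "norm h \<le> r" for h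
    proof -
      have "norm (x + h) \<le> norm x + r" using norm_triangle_ineq[of x h] that by simp
      from M[OF this] M[of x] exp[of 1 h x] that r show ?thesis by (simp add: r_def)
    qed
    have "\<bar>l x h\<bar> \<le> norm h * ((2 * M + r) / r)" for h
    proof (cases "h = 0")
      case True then show ?thesis using lin[of x] by (simp add: linear_0)
    next
      case False
      have "\<bar>l x ((r / norm h) *\<^sub>R h)\<bar> \<le> 2 * M + r" using False r by (intro ball) simp
      moreover have "l x ((r / norm h) *\<^sub>R h) = (r / norm h) * l x h"
        using linear_scale[OF lin] by simp
      ultimately have "\<bar>l x h\<bar> * r / norm h \<le> 2 * M + r" using r False by (simp add: abs_mult mult.commute)
      then show ?thesis using r False by (simp add: field_simps)
    qed
    then show ?thesis
      using lin[of x] by (intro bounded_linear_intro[where K = "(2 * M + r) / r"])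
        (auto simp: linear_add linear_scale)
  qed
  show ?thesis
    by (rule exI[of _ "\<lambda>x. Blinfun (l x)"]) (use exp bl in \<open>simp add: bounded_linear_Blinfun_apply\<close>)
qed

lemma uniformly_continuous_on_subset:
  fixes f :: "'a::metric_space \<Rightarrow> 'b::metric_space"
  assumes f: "uniformly_continuous_on S f" and sub: "T \<subseteq> S"
  shows "uniformly_continuous_on T f"
  unfolding uniformly_continuous_on_def
proof (intro allI impI)
  fix e :: real assume e: "0 < e"
  obtain d where "0 < d" "\<forall>x\<in>S. \<forall>x'\<in>S. dist x' x < d \<longrightarrow> dist (f x') (f x) < e"
    using f[unfolded uniformly_continuous_on_def, THEN spec[of _ e], THEN mp, OF e] by blast
  then show "\<exists>d>0. \<forall>x\<in>T. \<forall>x'\<in>T. dist x' x < d \<longrightarrow> dist (f x') (f x) < e"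
    using sub by (intro exI[of _ d]) (simp add: subset_iff)
qed

lemma DF_eqI:
  assumes "(F has_derivative blinfun_apply L) (at x)"
  shows "DF F x = L"
  unfolding DF_def frechet_derivative_at[OF assms, symmetric] by (rule blinfun_apply_inverse)

lemma has_derivative_DF:
  assumes "F differentiable (at x)"
  shows "(F has_derivative blinfun_apply (DF F x)) (at x)"
proof -
  have *: "(F has_derivative frechet_derivative F (at x)) (at x)"
    using assms by (simp only: frechet_derivative_works)
  show ?thesis
    unfolding DF_def bounded_linear_Blinfun_apply[OF has_derivative_bounded_linear[OF *]] by (rule *)
qed

text \<open>
The expansions at two nearby points \<open>x\<close> and \<open>y\<close>, compared at the common point \<open>y + k\<close> with
\<open>\<parallel>k\<parallel>\<close> comparable to the radius of validity, show that \<open>L x\<close> and \<open>L y\<close> differ by a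
multiple of \<open>e\<close>.
\<close>

lemma C1plusB_of_uniform_expansion:
  fixes F :: "'a::real_normed_vector \<Rightarrow> real" and L :: "'a \<Rightarrow> ('a \<Rightarrow>\<^sub>L real)"
  assumes d: "\<And>e. 0 < e \<Longrightarrow> 0 < d e"
    and exp: "\<And>e x h. 0 < e \<Longrightarrow> norm h \<le> d e \<Longrightarrow> \<bar>F (x + h) - F x - L x h\<bar> \<le> e * norm h"
  shows "F \<in> C1plusB UNIV" "DF F = L"
proof -
  have der: "(F has_derivative blinfun_apply (L x)) (at x)" for x
    unfolding has_derivative_at_alt
  proof (intro conjI allI impI)
    show "bounded_linear (blinfun_apply (L x))" by (rule blinfun.bounded_linear_right)
    fix e :: real assume "0 < e"
    then show "\<exists>c>0. \<forall>y. norm (y - x) < c \<longrightarrow> norm (F y - F x - L x (y - x)) \<le> e * norm (y - x)"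
      using exp[of e "_ - x" x] d[of e] by (intro exI[of _ "d e"]) auto
  qed
  then show DF: "DF F = L" by (auto intro: DF_eqI)
  have close: "norm (L x - L y) \<le> 4 * e" if e: "0 < e" and xy: "norm (y - x) \<le> d e / 2" for x y e
  proof (rule norm_blinfun_bound)
    show "0 \<le> 4 * e" using e by simp
    fix h :: 'a
    \<comment> \<open>test vectors of length r keep y - x + k within the radius of validity d e\<close>
    define r where "r = d e / 2"
    have r: "0 < r" using d e by (simp add: r_def)
    have main: "\<bar>(L x - L y) k\<bar> \<le> 4 * e * r" if k: "norm k = r" for k
    proof -
      have ne: "norm (y - x + k) \<le> 2 * r"
        using norm_triangle_ineq[of "y - x" k] xy k by (simp add: r_def)
      have "\<bar>F (y + k) - F y - L y k\<bar> \<le> e * norm k"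
        by (rule exp[OF e]) (use k r in \<open>simp add: r_def\<close>)
      moreover have "\<bar>F (y + k) - F x - L x (y - x + k)\<bar> \<le> e * norm (y - x + k)"
        using exp[OF e, of "y - x + k" x] ne by (simp add: r_def add_diff_eq)
      moreover have "\<bar>F y - F x - L x (y - x)\<bar> \<le> e * norm (y - x)"
        using exp[OF e, of "y - x" x] xy r by (simp add: r_def)
      moreover have "(L x - L y) k = (F (y + k) - F y - L y k) - (F (y + k) - F x - L x (y - x + k))
          + (F y - F x - L x (y - x))"
        by (simp add: blinfun.add_right blinfun.diff_left blinfun.diff_right)
      ultimately have "\<bar>(L x - L y) k\<bar> \<le> e * norm k + e * norm (y - x + k) + e * norm (y - x)"
        by linarith
      also have "\<dots> \<le> e * r + e * (2 * r) + e * r"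
        using e ne xy k by (intro add_mono mult_left_mono) (auto simp: r_def)
      finally show ?thesis by (simp add: algebra_simps)
    qed
    show "norm ((L x - L y) h) \<le> 4 * e * norm h"
    proof (cases "h = 0")
      case False
      have "\<bar>(L x - L y) ((r / norm h) *\<^sub>R h)\<bar> \<le> 4 * e * r" using r False by (intro main) simp
      then have "\<bar>(L x - L y) h\<bar> * r / norm h \<le> 4 * e * r"
        using r False by (simp add: blinfun.scaleR_right abs_mult mult.commute)
      then show ?thesis using r False by (simp add: field_simps)
    qed simp
  qed
  have "uniformly_continuous_on UNIV L"
    unfolding uniformly_continuous_on_def
  proof (intro allI impI)
    fix r :: real assume r: "0 < r"
    then have "dist (L y) (L x) < r" if "dist y x < d (r / 8) / 2" for x y
      using close[of "r / 8" y x] that by (simp add: dist_norm norm_minus_commute)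
    then show "\<exists>c>0. \<forall>x\<in>UNIV. \<forall>y\<in>UNIV. dist y x < c \<longrightarrow> dist (L y) (L x) < r"
      using d[of "r / 8"] r by (intro exI[of _ "d (r / 8) / 2"]) auto
  qed
  then have "uniformly_continuous_on B L" for B
    by (rule uniformly_continuous_on_subset) simp
  moreover have "F differentiable (at x)" for x
    using der differentiable_def by blast
  ultimately show "F \<in> C1plusB UNIV"
    by (simp add: C1plusB_def DF)
qed

section \<open>Jets and the necessity of the condition\<close>

text \<open>
The requirement that \<open>condition_W\<close> imposes on each bounded part of its set, isolated for a single set.
\<close>

definition jet_on :: "'a::real_normed_vector set \<Rightarrow> ('a \<Rightarrow> real) \<Rightarrow> ('a \<Rightarrow> ('a \<Rightarrow>\<^sub>L real)) \<Rightarrow> bool" where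
  "jet_on B f G \<longleftrightarrow> bounded (f ` B) \<and> bounded (G ` B) \<and> uniformly_continuous_on B G \<and>
     (\<forall>\<epsilon>>0. \<exists>\<delta>>0. \<forall>x\<in>B. \<forall>y\<in>B. norm (y - x) < \<delta> \<longrightarrow>
        \<bar>f y - f x - blinfun_apply (G x) (y - x)\<bar> \<le> \<epsilon> * norm (y - x))"

lemma condition_W_iff_jet_on:
  "condition_W E f G \<longleftrightarrow> (\<forall>B. B \<subseteq> E \<longrightarrow> bounded B \<longrightarrow> jet_on B f G)"
  unfolding condition_W_def jet_on_def ..

lemma jet_onD:
  assumes "jet_on B f G"
  shows "bounded (f ` B)" "bounded (G ` B)" "uniformly_continuous_on B G"
    "\<And>e. 0 < e \<Longrightarrow> \<exists>\<delta>>0. \<forall>x\<in>B. \<forall>y\<in>B. norm (y - x) < \<delta> \<longrightarrow>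
        \<bar>f y - f x - blinfun_apply (G x) (y - x)\<bar> \<le> e * norm (y - x)"
  using assms by (simp_all add: jet_on_def)

text \<open>
Balls need not be totally bounded in infinite dimensions; instead every point is joined to the centre by a chain
of \<open>n\<close> steps along a radius, each short enough to change \<open>g\<close> by less than 1.
\<close>

lemma bounded_uniformly_continuous_image_cball:
  fixes g :: "'a::real_normed_vector \<Rightarrow> 'b::metric_space"
  assumes "uniformly_continuous_on (cball 0 r) g"
  shows "bounded (g ` cball 0 r)"
proof (cases "0 < r")
  case False
  then have "cball (0::'a) r \<subseteq> {0}"
  proof -
    have "x = 0" if "norm x \<le> r" for x :: 'a
    proof -
      have "norm x \<le> 0" using that False by linarith
      then show ?thesis by simp
    qed
    then show ?thesis by auto
  qed
  then have "g ` cball 0 r \<subseteq> {g 0}" by auto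
  then show ?thesis by (rule bounded_subset[rotated]) simp
next
  case True
  obtain c where c: "0 < c"
    "\<forall>x\<in>cball 0 r. \<forall>y\<in>cball 0 r. dist y x < c \<longrightarrow> dist (g y) (g x) < 1"
      using assms[unfolded uniformly_continuous_on_def, THEN spec[of _ 1], THEN mp, OF zero_less_one] by blast
  obtain n :: nat where n: "r / c < real n" using reals_Archimedean2 by blast
  then have n0: "0 < real n" using divide_pos_pos[OF True c(1)] by linarith
  have "dist (g ((real k / real n) *\<^sub>R x)) (g 0) \<le> real k" if x: "x \<in> cball 0 r" and "k \<le> n" for x k
    using that(2)
  proof (induction k)
    case (Suc k)
    have in_ball: "(real j / real n) *\<^sub>R x \<in> cball 0 r" if "j \<le> n" for j
    proof -
      have "(real j / real n) * norm x \<le> 1 * r" using x that n0 by (intro mult_mono) auto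
      then show ?thesis by simp
    qed
    have "dist ((real (Suc k) / real n) *\<^sub>R x) ((real k / real n) *\<^sub>R x) = norm x / real n"
      unfolding dist_norm scaleR_diff_left[symmetric] by (simp add: diff_divide_distrib[symmetric])
    also have "\<dots> \<le> r / real n" using x n0 by (simp add: divide_right_mono)
    also have "\<dots> < c" using n n0 c(1) by (simp add: field_simps)
    finally have "dist (g ((real (Suc k) / real n) *\<^sub>R x)) (g ((real k / real n) *\<^sub>R x)) < 1"
      using Suc.prems by (intro c(2)[rule_format] in_ball) auto
    with Suc show ?case
      using dist_triangle[of "g ((real (Suc k) / real n) *\<^sub>R x)" "g 0" "g ((real k / real n) *\<^sub>R x)"]
      by simp
  qed simp
  from this[of _ n] have "dist (g 0) (g x) \<le> real n" if "x \<in> cball 0 r" for x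
    using that n0 by (subst dist_commute) simp
  then show ?thesis unfolding bounded_def by blast
qed

lemma condition_W_of_C1plusB:
  fixes F :: "'a::real_normed_vector \<Rightarrow> real"
  assumes F: "F \<in> C1plusB UNIV"
  shows "condition_W UNIV F (DF F)"
  unfolding condition_W_iff_jet_on
proof (intro allI impI)
  fix B :: "'a set" assume "bounded B"
  then obtain r where "\<forall>x\<in>B. norm x \<le> r"
    unfolding bounded_iff by auto
  then have r: "B \<subseteq> cball 0 r" by auto
  have der: "(F has_derivative blinfun_apply (DF F x)) (at x within S)" for x S
    using F unfolding C1plusB_def by (auto intro: has_derivative_DF has_derivative_at_withinI)
  have uc: "uniformly_continuous_on (cball 0 r) (DF F)"
    using F bounded_cball unfolding C1plusB_def by blast
  then have bd: "bounded (DF F ` cball 0 r)" by (rule bounded_uniformly_continuous_image_cball)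
  have approx: "\<bar>F y - F x - DF F x (y - x)\<bar> \<le> e * norm (y - x)"
    if "x \<in> cball 0 r" "y \<in> cball 0 r" 
      "\<And>z. z \<in> closed_segment x y \<Longrightarrow> norm (DF F z - DF F x) \<le> e" for x y e
  proof -
    have "norm ((F y - DF F x y) - (F x - DF F x x)) \<le> e * norm (y - x)"
    proof (rule differentiable_bound)
      show "((\<lambda>z. F z - DF F x z) has_derivative blinfun_apply (DF F z - DF F x)) 
          (at z within closed_segment x y)" for z
        unfolding minus_blinfun.rep_eq
        by (intro has_derivative_diff der bounded_linear_imp_has_derivative blinfun.bounded_linear_right)
      show "onorm (blinfun_apply (DF F z - DF F x)) \<le> e" if "z \<in> closed_segment x y" for z
        using that(1) \<open>\<And>z. z \<in> closed_segment x y \<Longrightarrow> _\<close> by (simp add: norm_blinfun.rep_eq)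
    qed auto
    then show ?thesis by (simp add: blinfun.diff_right)
  qed
  have seg: "closed_segment x y \<subseteq> cball 0 r" if "x \<in> cball 0 r" "y \<in> cball 0 r" for x y :: 'a
    using that by (intro closed_segment_subset convex_cball)
  obtain M where M: "0 < M" "\<And>x. x \<in> cball 0 r \<Longrightarrow> norm (DF F x) \<le> M"
    using bd unfolding bounded_pos by (auto simp: image_iff)
  have "\<bar>F x\<bar> \<le> \<bar>F 0\<bar> + 3 * M * r" if x: "x \<in> cball 0 r" for x
  proof -
    have x0: "0 \<in> cball (0::'a) r" using x order_trans[OF norm_ge_zero[of x], of r] by simp
    have "norm (DF F z - DF F 0) \<le> 2 * M" if "z \<in> closed_segment 0 x" for z
      using norm_triangle_ineq4[of "DF F z" "DF F 0"] M(2)[OF subsetD[OF seg[OF x0 x] that]] M(2)[OF x0]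
      by simp
    from approx[OF x0 x this] have 1: "\<bar>F x - F 0 - DF F 0 x\<bar> \<le> 2 * M * norm x" by simp
    have 2: "\<bar>DF F 0 x\<bar> \<le> M * norm x"
      using norm_blinfun[of "DF F 0" x] M(2)[OF x0]
        mult_right_mono[OF M(2)[OF x0] norm_ge_zero[of x]] by simp
    have "M * norm x \<le> M * r" using x M(1) by simp
    with 1 2 show ?thesis by linarith
  qed
  then have bdF: "bounded (F ` B)"
    using subsetD[OF r] by (intro boundedI[where B = "\<bar>F 0\<bar> + 3 * M * r"]) auto
  show "jet_on B F (DF F)"
    unfolding jet_on_def
  proof (intro conjI allI impI)
    show "bounded (F ` B)" by (rule bdF)
    show "bounded (DF F ` B)" by (rule bounded_subset[OF bd image_mono[OF r]])
    show "uniformly_continuous_on B (DF F)" by (rule uniformly_continuous_on_subset[OF uc r])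
    fix e :: real assume e: "0 < e"
    obtain c where c: "0 < c"
      "\<forall>x\<in>cball 0 r. \<forall>y\<in>cball 0 r. dist y x < c \<longrightarrow> dist (DF F y) (DF F x) < e"
      using uc[unfolded uniformly_continuous_on_def, THEN spec[of _ e], THEN mp, OF e] by blast
    have "\<bar>F y - F x - DF F x (y - x)\<bar> \<le> e * norm (y - x)"
      if xy: "x \<in> cball 0 r" "y \<in> cball 0 r" "norm (y - x) < c" for x y
    proof (rule approx[OF xy(1,2)])
      fix z assume z: "z \<in> closed_segment x y"
      obtain u where u: "0 \<le> u" "u \<le> 1" "z = (1 - u) *\<^sub>R x + u *\<^sub>R y"
        using z unfolding in_segment by blast
      then have "z - x = u *\<^sub>R (y - x)" by (simp add: algebra_simps)
      then have "dist z x \<le> norm (y - x)"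
        using u by (simp add: dist_norm mult_left_le_one_le)
      then have "dist (DF F z) (DF F x) < e"
        using xy z seg[OF xy(1,2)] by (intro c(2)[rule_format]) auto
      then show "norm (DF F z - DF F x) \<le> e" by (simp add: dist_norm)
    qed
    then show "\<exists>\<delta>>0. \<forall>x\<in>B. \<forall>y\<in>B. norm (y - x) < \<delta> \<longrightarrow>
        \<bar>F y - F x - DF F x (y - x)\<bar> \<le> e * norm (y - x)" using c(1) subsetD[OF r] by (intro exI[of _ c]) auto
  qed
qed

section \<open>A smooth kernel dominating a given remainder\<close>

text \<open>
A smooth substitute for \<open>max 0 (t - r)\<close>: it has slope 0 at 0 and is comparable to \<open>t\<close> from \<open>r\<close>
on, it is convex and 1-Lipschitz, and its second derivative is at most \<open>2 / r\<close>.
\<close>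

definition soft :: "real \<Rightarrow> real \<Rightarrow> real" where
  "soft r t = t\<^sup>2 / (t + r)"

lemma soft_eq: "0 < r \<Longrightarrow> 0 \<le> t \<Longrightarrow> soft r t = t - r + r\<^sup>2 / (t + r)"
  by (simp add: soft_def field_simps power2_eq_square)

lemma soft_diff:
  assumes "0 < r" "0 \<le> s" "0 \<le> t"
  shows "soft r t - soft r s = (t - s) * (1 - r\<^sup>2 / ((s + r) * (t + r)))"
  using assms by (simp add: soft_eq divide_simps) algebra

lemma soft_nonneg: "0 < r \<Longrightarrow> 0 \<le> t \<Longrightarrow> 0 \<le> soft r t"
  by (simp add: soft_def)

lemma soft_0 [simp]: "soft r 0 = 0"
  by (simp add: soft_def)

lemma soft_ge_half: "0 < r \<Longrightarrow> r \<le> t \<Longrightarrow> t / 2 \<le> soft r t"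
  by (simp add: soft_def field_simps power2_eq_square)

lemma soft_factor:
  fixes r s t :: real
  assumes "0 < r" "0 \<le> s" "0 \<le> t"
  shows "0 \<le> 1 - r\<^sup>2 / ((s + r) * (t + r))" "1 - r\<^sup>2 / ((s + r) * (t + r)) \<le> 1"
proof -
  have "r * r \<le> (s + r) * (t + r)" using assms by (intro mult_mono) auto
  moreover have "0 < (s + r) * (t + r)" using assms by auto
  ultimately show "0 \<le> 1 - r\<^sup>2 / ((s + r) * (t + r))" "1 - r\<^sup>2 / ((s + r) * (t + r)) \<le> 1"
    by (auto simp: power2_eq_square)
qed

lemma soft_mono:
  assumes "0 < r" "0 \<le> s" "s \<le> t"
  shows "soft r s \<le> soft r t"
proof -
  have "0 \<le> (t - s) * (1 - r\<^sup>2 / ((s + r) * (t + r)))"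
    using assms soft_factor[of r s t] by (intro mult_nonneg_nonneg) auto
  then show ?thesis using soft_diff[of r s t] assms by simp
qed

lemma soft_lipschitz:
  assumes "0 < r" "0 \<le> s" "s \<le> t"
  shows "soft r t - soft r s \<le> t - s"
proof -
  have "(t - s) * (1 - r\<^sup>2 / ((s + r) * (t + r))) \<le> (t - s) * 1"
    using assms soft_factor[of r s t] by (intro mult_left_mono) auto
  then show ?thesis using soft_diff[of r s t] assms by simp
qed

lemma soft_slope:
  assumes r: "0 < r" and st: "0 \<le> s" "s \<le> t"
  shows "soft r t - soft r s \<le> (2 * t / r) * (t - s)"
proof -
  let ?P = "(s + r) * (t + r)"
  have P: "0 < ?P" using assms by auto
  have "r * (?P - r\<^sup>2) = r * (s * t) + r * r * (s + t)"
    by (simp add: algebra_simps power2_eq_square)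
  also have "\<dots> \<le> r * (s * t) + r * r * (2 * t)"
    using assms by (intro add_mono mult_left_mono) auto
  also have "\<dots> \<le> 2 * t * ?P"
    using assms by (simp add: algebra_simps)
  finally have "1 - r\<^sup>2 / ?P \<le> 2 * t / r"
    using r P by (simp add: field_simps)
  then have "(t - s) * (1 - r\<^sup>2 / ?P) \<le> (t - s) * (2 * t / r)"
    using st by (intro mult_left_mono) auto
  then show ?thesis using soft_diff[of r s t] assms by (simp add: mult.commute)
qed

lemma soft_second_difference:
  assumes r: "0 < r" and v: "\<bar>v\<bar> \<le> t"
  shows "soft r (t + v) + soft r (t - v) - 2 * soft r t \<le> 2 * v\<^sup>2 / r"
proof -
  define T where "T = t + r"
  have T: "r \<le> T" "\<bar>v\<bar> < T" using assms by (auto simp: T_def)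
  have "soft r (t + v) + soft r (t - v) - 2 * soft r t = r\<^sup>2 / (T + v) + r\<^sup>2 / (T - v) - 2 * r\<^sup>2 / T"
    using assms by (simp add: soft_eq T_def algebra_simps)
  also have "\<dots> = 2 * v\<^sup>2 * (r\<^sup>2 / (T * (T\<^sup>2 - v\<^sup>2)))"
  proof -
    have "T + v \<noteq> 0" "T - v \<noteq> 0" "T \<noteq> 0" using T r by auto
    moreover have "T\<^sup>2 - v\<^sup>2 = (T + v) * (T - v)" by (simp add: algebra_simps power2_eq_square)
    ultimately show ?thesis by (simp add: divide_simps) (simp add: algebra_simps power2_eq_square)
  qed
  also have "\<dots> \<le> 2 * v\<^sup>2 * (1 / r)"
  proof (rule mult_left_mono)
    have "v\<^sup>2 \<le> t\<^sup>2" using v power_mono[OF v abs_ge_zero, of 2] by simp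
    moreover have "t\<^sup>2 + r\<^sup>2 \<le> T\<^sup>2" using assms by (simp add: T_def power2_sum)
    ultimately have "r\<^sup>2 \<le> T\<^sup>2 - v\<^sup>2" by simp
    then have "r * r\<^sup>2 \<le> T * (T\<^sup>2 - v\<^sup>2)" using r T by (intro mult_mono) auto
    moreover have "0 < r * r\<^sup>2" using r by simp
    ultimately show "r\<^sup>2 / (T * (T\<^sup>2 - v\<^sup>2)) \<le> 1 / r"
      using r frac_le[of "r * r\<^sup>2" "r * r\<^sup>2" "r * r\<^sup>2" "T * (T\<^sup>2 - v\<^sup>2)"]
      by (simp add: field_simps)
  qed auto
  finally show ?thesis by simp
qed

lemma convex_on_soft:
  assumes "0 < r"
  shows "convex_on {0..} (soft r)"
proof (rule convex_on_realI)
  show "connected {0::real..}" by simp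
  fix t :: real assume t: "t \<in> {0..}"
  show "(soft r has_real_derivative (2 * t * (t + r) - t\<^sup>2) / (t + r)\<^sup>2) (at t)"
    unfolding soft_def[abs_def] using t assms
    by (auto intro!: derivative_eq_intros simp: power2_eq_square)
next
  fix s t :: real assume *: "s \<in> {0..}" "t \<in> {0..}" "s \<le> t"
  have eq: "(2 * u * (u + r) - u\<^sup>2) / (u + r)\<^sup>2 = 1 - (r / (u + r))\<^sup>2" if "0 \<le> u" for u
    using that assms by (simp add: power_divide divide_simps) (simp add: algebra_simps power2_eq_square)
  have "r / (t + r) \<le> r / (s + r)"
    using * assms by (intro divide_left_mono) auto
  then have "(r / (t + r))\<^sup>2 \<le> (r / (s + r))\<^sup>2"
    using * assms by (intro power_mono) auto
  then show "(2 * s * (s + r) - s\<^sup>2) / (s + r)\<^sup>2 \<le> (2 * t * (t + r) - t\<^sup>2) / (t + r)\<^sup>2"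
    using * eq by simp
qed

lemma equivalent_normD:
  assumes "equivalent_norm N"
  shows "0 \<le> N x" "N x = 0 \<longleftrightarrow> x = 0" "N (c *\<^sub>R x) = \<bar>c\<bar> * N x" "N (x + y) \<le> N x + N y"
    "N (- x) = N x" "N (x - y) \<le> N x + N y" "\<bar>N x - N y\<bar> \<le> N (x - y)"
proof -
  show 1: "0 \<le> N x" "N x = 0 \<longleftrightarrow> x = 0" "N (c *\<^sub>R x) = \<bar>c\<bar> * N x" "N (x + y) \<le> N x + N y" for x y c
    using assms by (simp_all add: equivalent_norm_def)
  show 2: "N (- x) = N x" for x using 1(3)[of "-1" x] by simp
  show "N (x - y) \<le> N x + N y" using 1(4)[of x "- y"] 2[of y] by simp
  have "N (y - x) = N (x - y)" using 2[of "x - y"] by simp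
  then show "\<bar>N x - N y\<bar> \<le> N (x - y)"
    using 1(4)[of "x - y" y] 1(4)[of "y - x" x] by simp
qed

lemma equivalent_norm_bounds:
  assumes "equivalent_norm N"
  obtains a b where "0 < a" "0 < b" "\<And>x. a * norm x \<le> N x" "\<And>x. N x \<le> b * norm x"
  using assms unfolding equivalent_norm_def by blast

text \<open>
Near the origin, where \<open>N\<close> is not smooth, the slope of \<open>soft r\<close> is small. Away from the origin, uniform
smoothness rescaled from the unit sphere makes \<open>N(x + h) + N(x - h)\<close> nearly \<open>2 N x\<close>, and \<open>soft r\<close>
contributes a second difference of order \<open>(N h)\<^sup>2 / r\<close>.
\<close>

lemma soft_norm_second_difference:
  fixes N :: "'a::real_normed_vector \<Rightarrow> real"
  assumes N: "equivalent_norm N" "uniformly_smooth_norm N" and r: "0 < r" and e: "0 < e"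
  obtains d where "0 < d"
    "\<And>x h. N h \<le> d \<Longrightarrow> soft r (N (x + h)) + soft r (N (x - h)) \<le> 2 * soft r (N x) + e * N h"
proof -
  note n = equivalent_normD[OF N(1)]
  define c where "c = e * r / 8"
  have c: "0 < c" using e r by (simp add: c_def)
  obtain q where q: "0 < q" "\<And>u v. N u = 1 \<Longrightarrow> N v \<le> q \<Longrightarrow> N (u + v) + N (u - v) \<le> 2 + e / 2 * N v"
    using N(2)[unfolded uniformly_smooth_norm_def, rule_format, of "e / 2"] e by auto
  have "soft r (N (x + h)) + soft r (N (x - h)) \<le> 2 * soft r (N x) + e * N h"
    if h: "N h \<le> min c (c * q)" for x h
  proof -
    define t where "t = N x"
    define s where "s = N h"
    have ts: "0 \<le> t" "0 \<le> s" "s \<le> c" "s \<le> c * q" using n(1) h by (auto simp: t_def s_def)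
    show ?thesis
    proof (cases "t < c")
      case True
      have "soft r (t + s) - soft r t \<le> 2 * (t + s) / r * s"
        using soft_slope[OF r ts(1), of "t + s"] ts by simp
      also have "\<dots> \<le> 2 * (2 * c) / r * s"
        using True ts r by (intro mult_right_mono divide_right_mono) auto
      also have "\<dots> = e / 2 * s" using r by (simp add: c_def)
      finally have 1: "soft r (t + s) \<le> soft r t + e / 2 * s" by simp
      have "soft r (N (x + h)) \<le> soft r (t + s)" "soft r (N (x - h)) \<le> soft r (t + s)"
        using n(1,4,6) by (auto intro!: soft_mono[OF r] simp: t_def s_def)
      with 1 show ?thesis by (simp add: t_def s_def)
    next
      case False
      then have t: "0 < t" using c by simp
      define A where "A = N (x + h)"
      define B where "B = N (x - h)"
      have At: "\<bar>A - t\<bar> \<le> s" using n(7)[of "x + h" x] by (simp add: A_def t_def s_def)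
      have AB: "A + B \<le> 2 * t + e / 2 * s"
      proof -
        have 1: "N ((1 / t) *\<^sub>R x) = 1" "N ((1 / t) *\<^sub>R h) = s / t"
          using t by (simp_all add: n(3) t_def s_def)
        have "s \<le> t * q" using ts(4) False q(1) by (smt (verit) mult_right_mono)
        then have "N ((1 / t) *\<^sub>R h) \<le> q" unfolding 1 using t by (simp add: divide_le_eq mult.commute)
        from q(2)[OF 1(1) this] have "N ((1 / t) *\<^sub>R (x + h)) + N ((1 / t) *\<^sub>R (x - h)) \<le> 2 + e / 2 * (s / t)"
          unfolding 1 by (simp add: scaleR_add_right scaleR_diff_right)
        then have "(A + B) / t \<le> 2 + e / 2 * (s / t)"
          using t unfolding n(3) by (simp add: A_def B_def add_divide_distrib)
        moreover have "2 + e / 2 * (s / t) = (2 * t + e / 2 * s) / t"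
          using t by (simp add: field_simps)
        ultimately show ?thesis using t by (simp only: divide_le_cancel)
      qed
      have "soft r B \<le> soft r (2 * t - A + e / 2 * s)"
        using AB n(1) by (intro soft_mono[OF r]) (auto simp: B_def)
      also have "\<dots> \<le> soft r (2 * t - A) + e / 2 * s"
      proof -
        have "0 \<le> 2 * t - A" "0 \<le> e / 2 * s" using At ts False e by auto
        then show ?thesis
          using soft_lipschitz[OF r, of "2 * t - A" "2 * t - A + e / 2 * s"] by simp
      qed
      finally have 1: "soft r B \<le> soft r (t - (A - t)) + e / 2 * s" by (simp add: algebra_simps)
      have "soft r (t + (A - t)) + soft r (t - (A - t)) - 2 * soft r t \<le> 2 * (A - t)\<^sup>2 / r"
        using At ts False by (intro soft_second_difference[OF r]) auto
      also have "\<dots> \<le> 2 * (c * s) / r"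
      proof -
        have "(A - t)\<^sup>2 \<le> s\<^sup>2" using power_mono[OF At abs_ge_zero, of 2] by simp
        also have "\<dots> \<le> c * s" using ts by (simp add: power2_eq_square mult_right_mono)
        finally show ?thesis using r by (simp add: divide_right_mono)
      qed
      also have "\<dots> \<le> e / 2 * s" using r e ts by (simp add: c_def)
      finally show ?thesis using 1 by (simp add: A_def B_def t_def s_def)
    qed
  qed
  then show thesis using that[of "min c (c * q)"] c q(1) by simp
qed

text \<open>
For a convex function the symmetric second differences control the asymmetric ones. If \<open>t \<le> 1 / 2\<close>, the nearer
endpoint \<open>x - t h\<close> lies between \<open>x\<close> and \<open>x - (1 - t) h\<close>, so convexity replaces it by the reflection of the
farther endpoint \<open>x + (1 - t) h\<close>.
\<close>

lemma convex_second_difference: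
  fixes g :: "'a::real_vector \<Rightarrow> real"
  assumes g: "convex_on UNIV g" and t: "0 \<le> t" "t \<le> 1"
    and sd: "\<And>s. 0 \<le> s \<Longrightarrow> s \<le> 1 \<Longrightarrow> g (x + s *\<^sub>R h) + g (x - s *\<^sub>R h) \<le> 2 * g x + s * R"
  shows "t * g (x + (1 - t) *\<^sub>R h) + (1 - t) * g (x - t *\<^sub>R h) \<le> g x + t * (1 - t) * R"
proof -
  have half: "t * g (x + (1 - t) *\<^sub>R h) + (1 - t) * g (x - t *\<^sub>R h) \<le> g x + t * (1 - t) * R"
    if t: "0 \<le> t" "t \<le> 1 / 2" 
      and sd: "\<And>s. 0 \<le> s \<Longrightarrow> s \<le> 1 \<Longrightarrow> g (x + s *\<^sub>R h) + g (x - s *\<^sub>R h) \<le> 2 * g x + s * R" for t h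
  proof -
    define l where "l = t / (1 - t)"
    have l: "0 \<le> l" "l \<le> 1" "l * (1 - t) = t" using t by (auto simp: l_def)
    have "x - (l * (1 - t)) *\<^sub>R h = (1 - l) *\<^sub>R x + l *\<^sub>R (x - (1 - t) *\<^sub>R h)"
      by (simp add: algebra_simps)
    then have "x - t *\<^sub>R h = (1 - l) *\<^sub>R x + l *\<^sub>R (x - (1 - t) *\<^sub>R h)"
      unfolding l(3) .
    then have "g (x - t *\<^sub>R h) \<le> (1 - l) * g x + l * g (x - (1 - t) *\<^sub>R h)"
      using convex_onD[OF g l(1,2), of x "x - (1 - t) *\<^sub>R h"] by simp
    then have "(1 - t) * g (x - t *\<^sub>R h) \<le> (1 - t) * ((1 - l) * g x + l * g (x - (1 - t) *\<^sub>R h))"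
      using t by (intro mult_left_mono) auto
    also have "\<dots> = ((1 - t) - l * (1 - t)) * g x + (l * (1 - t)) * g (x - (1 - t) *\<^sub>R h)"
      by (simp add: algebra_simps)
    finally have 1: "(1 - t) * g (x - t *\<^sub>R h) \<le> (1 - 2 * t) * g x + t * g (x - (1 - t) *\<^sub>R h)"
      unfolding l(3) by (simp add: algebra_simps)
    have "t * (g (x + (1 - t) *\<^sub>R h) + g (x - (1 - t) *\<^sub>R h)) \<le> t * (2 * g x + (1 - t) * R)"
      using t by (intro mult_left_mono sd) auto
    with 1 show ?thesis by (simp add: algebra_simps)
  qed
  show ?thesis
  proof (cases "t \<le> 1 / 2")
    case False
    have "(1 - t) * g (x + (1 - (1 - t)) *\<^sub>R (- h)) + (1 - (1 - t)) * g (x - (1 - t) *\<^sub>R (- h))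
        \<le> g x + (1 - t) * (1 - (1 - t)) * R"
      using t False sd by (intro half) (auto simp: add.commute)
    then show ?thesis by (simp add: algebra_simps)
  qed (use half t sd in blast)
qed

lemma convex_on_soft_norm:
  assumes N: "equivalent_norm N" and r: "0 < r"
  shows "convex_on UNIV (\<lambda>x. soft r (N x))"
proof (rule convex_onI)
  fix t :: real and x y assume t: "0 < t" "t < 1"
  note n = equivalent_normD[OF N]
  have "soft r (N ((1 - t) *\<^sub>R x + t *\<^sub>R y)) \<le> soft r ((1 - t) * N x + t * N y)"
    using n(4)[of "(1 - t) *\<^sub>R x" "t *\<^sub>R y"] t n(1) by (intro soft_mono[OF r]) (auto simp: n(3))
  also have "\<dots> \<le> (1 - t) * soft r (N x) + t * soft r (N y)"
    using convex_onD[OF convex_on_soft[OF r], of t "N x" "N y"] t n(1) by simp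
  finally show "soft r (N ((1 - t) *\<^sub>R x + t *\<^sub>R y)) \<le> (1 - t) * soft r (N x) + t * soft r (N y)" .
qed simp

lemma soft_norm_semiconcave:
  fixes N :: "'a::real_normed_vector \<Rightarrow> real"
  assumes N: "equivalent_norm N" "uniformly_smooth_norm N" and r: "0 < r" and e: "0 < e"
  obtains d where "0 < d"
    "\<And>x h t. norm h \<le> d \<Longrightarrow> 0 \<le> t \<Longrightarrow> t \<le> 1 \<Longrightarrow>
      t * soft r (N (x + (1 - t) *\<^sub>R h)) + (1 - t) * soft r (N (x - t *\<^sub>R h))
      \<le> soft r (N x) + t * (1 - t) * (e * norm h)"
proof -
  note n = equivalent_normD[OF N(1)]
  obtain b where b: "0 < b" "\<And>x. N x \<le> b * norm x" using equivalent_norm_bounds[OF N(1)] by metis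
  obtain d where d: "0 < d"
    "\<And>x h. N h \<le> d \<Longrightarrow> soft r (N (x + h)) + soft r (N (x - h)) \<le> 2 * soft r (N x) + (e / b) * N h"
    using soft_norm_second_difference[OF N r, of "e / b"] e b(1) by (metis divide_pos_pos)
  have "t * soft r (N (x + (1 - t) *\<^sub>R h)) + (1 - t) * soft r (N (x - t *\<^sub>R h))
      \<le> soft r (N x) + t * (1 - t) * (e * norm h)"
    if h: "norm h \<le> d / b" and t: "0 \<le> t" "t \<le> 1" for x h t
  proof (rule convex_second_difference[OF convex_on_soft_norm[OF N(1) r] t])
    fix s :: real assume s: "0 \<le> s" "s \<le> 1"
    have Nh: "N (s *\<^sub>R h) \<le> s * (b * norm h)" using s b(2) by (simp add: n(3) mult_left_mono)
    have bh: "b * norm h \<le> d" using h b(1) by (simp add: field_simps)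
    have "s * (b * norm h) \<le> 1 * d" using s bh b(1) by (intro mult_mono) auto
    with Nh have "N (s *\<^sub>R h) \<le> d" by simp
    from d(2)[OF this, of x]
    have "soft r (N (x + s *\<^sub>R h)) + soft r (N (x - s *\<^sub>R h)) \<le> 2 * soft r (N x) + (e / b) * N (s *\<^sub>R h)" .
    also have "\<dots> \<le> 2 * soft r (N x) + (e / b) * (s * (b * norm h))"
      using e b(1) Nh by (intro add_left_mono mult_left_mono) auto
    finally show "soft r (N (x + s *\<^sub>R h)) + soft r (N (x - s *\<^sub>R h)) \<le> 2 * soft r (N x) + s * (e * norm h)"
      using b(1) by (simp add: mult_ac)
  qed
  then show thesis using that[of "d / b"] d(1) b(1) by simp
qed

lemma soft_norm_lipschitz:
  assumes N: "equivalent_norm N" and r: "0 < r"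
  shows "soft r (N (x + h)) \<le> soft r (N x) + N h"
proof -
  note n = equivalent_normD[OF N]
  have "soft r (N (x + h)) \<le> soft r (N x + N h)" using n by (intro soft_mono[OF r]) auto
  also have "\<dots> \<le> soft r (N x) + N h" using soft_lipschitz[OF r, of "N x" "N x + N h"] n(1) by simp
  finally show ?thesis .
qed

text \<open>
\<open>\<Phi>\<close> is a series of functions \<open>soft (s k) (N u)\<close>, in which the \<open>k\<close>-th term alone gives the
required lower bound at scale \<open>r k\<close>. For a given \<open>e\<close>, finitely many terms are semiconcave with a small
constant on a common scale, while the remaining ones have small Lipschitz constants.
\<close>

lemma smooth_kernel:
  fixes N :: "'a::real_normed_vector \<Rightarrow> real" and r :: "nat \<Rightarrow> real"
  assumes N: "equivalent_norm N" "uniformly_smooth_norm N"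
    and r: "\<And>k. 0 < r k" and K: "0 < K"
  obtains \<Phi> :: "'a \<Rightarrow> real" and d M where
    "\<And>e. 0 < e \<Longrightarrow> 0 < d e" "semiconvex d (\<lambda>x. - \<Phi> x)"
    "\<Phi> 0 = 0" "\<And>u. 0 \<le> \<Phi> u" "0 \<le> M" "\<And>u. \<Phi> u \<le> M * norm u"
    "\<And>k u. r k \<le> norm u \<Longrightarrow> K * (1 / 4) ^ k * norm u \<le> \<Phi> u"
proof -
  note n = equivalent_normD[OF N(1)]
  obtain a b where ab: "0 < a" "0 < b" "\<And>x. a * norm x \<le> N x" "\<And>x. N x \<le> b * norm x"
    using equivalent_norm_bounds[OF N(1)] by metis
  \<comment> \<open>one factor 2 for soft r t \<open>\<ge>\<close> t / 2, the factor 1 / a for passing from N to the given norm\<close>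
  define C where "C = 2 * K / a"
  have C: "0 < C" using K ab by (simp add: C_def)
  define s where "s = (\<lambda>k. a * r k)"
  have s: "0 < s k" for k using ab r by (simp add: s_def)
  define p where "p = (\<lambda>k u. C * (1 / 4) ^ k * soft (s k) (N u))"
  define \<Phi> where "\<Phi> = (\<lambda>u. \<Sum>k. p k u)"
  have p0: "0 \<le> p k u" for k u
    using C soft_nonneg[OF s n(1)] by (simp add: p_def)
  have pow: "(1 / 4) ^ k \<le> (1 / 2 :: real) ^ k" for k by (intro power_mono) auto
  have geo: "summable (\<lambda>k. (1 / 2 :: real) ^ k)" "(\<Sum>k. (1 / 2 :: real) ^ k) = 2"
    using suminf_geometric[of "1 / 2 :: real"] by simp_all
  have pN: "p k u \<le> C * N u * (1 / 2) ^ k" for k u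
  proof -
    have "soft (s k) (N u) \<le> N u" using soft_lipschitz[OF s, of 0 "N u"] n(1) by simp
    then have "(1 / 4) ^ k * soft (s k) (N u) \<le> (1 / 2) ^ k * N u"
      using pow n(1) soft_nonneg[OF s n(1)] by (intro mult_mono) auto
    then show ?thesis using C by (simp add: p_def mult_ac)
  qed
  have sumN: "summable (\<lambda>k. c * (1 / 2) ^ k)" for c :: real using geo(1) by (rule summable_mult)
  have sump: "summable (\<lambda>k. p k u)" for u
    by (rule summable_comparison_test'[OF sumN[of "C * N u"]]) (use p0 pN in auto)
  have sd: "\<exists>d>0. \<forall>x h t. norm h \<le> d \<longrightarrow> 0 \<le> t \<longrightarrow> t \<le> 1 \<longrightarrow>
      t * \<Phi> (x + (1 - t) *\<^sub>R h) + (1 - t) * \<Phi> (x - t *\<^sub>R h) \<le> \<Phi> x + e * t * (1 - t) * norm h"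
    if e: "0 < e" for e
  proof -
    \<comment> \<open>the errors below sum to \<open>4 C e'\<close>: a factor 2 in each term and 2 from the geometric series\<close>
    define e' where "e' = e / (4 * C)"
    have e': "0 < e'" using e C by (simp add: e'_def)
    have "\<exists>d>0. \<forall>x h t. norm h \<le> d \<longrightarrow> 0 \<le> t \<longrightarrow> t \<le> 1 \<longrightarrow>
      t * soft (s k) (N (x + (1 - t) *\<^sub>R h)) + (1 - t) * soft (s k) (N (x - t *\<^sub>R h))
      \<le> soft (s k) (N x) + t * (1 - t) * (e' * norm h)" for k
      by (rule soft_norm_semiconcave[OF N s[of k] e']) blast
    then obtain D where D: "\<And>k. 0 < D k"
      "\<And>k x h t. norm h \<le> D k \<Longrightarrow> 0 \<le> t \<Longrightarrow> t \<le> 1 \<Longrightarrow>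
      t * soft (s k) (N (x + (1 - t) *\<^sub>R h)) + (1 - t) * soft (s k) (N (x - t *\<^sub>R h))
      \<le> soft (s k) (N x) + t * (1 - t) * (e' * norm h)"
      by metis
    have "(\<lambda>m. 2 * b / 2 ^ m) \<longlonglongrightarrow> 0" by (rule LIMSEQ_divide_realpow_zero) simp
    then obtain m where m: "2 * b / 2 ^ m < e'"
      using order_tendstoD(2)[OF _ e'] eventually_sequentially by (metis (no_types, lifting) order_refl)
    define \<delta> where "\<delta> = Min (insert 1 (D ` {..<m}))"
    have \<delta>: "0 < \<delta>" "\<And>k. k < m \<Longrightarrow> \<delta> \<le> D k"
      using D(1) by (auto simp: \<delta>_def)
    have "t * \<Phi> (x + (1 - t) *\<^sub>R h) + (1 - t) * \<Phi> (x - t *\<^sub>R h) \<le> \<Phi> x + e * t * (1 - t) * norm h"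
      if h: "norm h \<le> \<delta>" and t: "0 \<le> t" "t \<le> 1" for x h t
    proof -
      define R where "R = t * (1 - t) * norm h"
      have R: "0 \<le> R" using t by (simp add: R_def)
      let ?y = "x + (1 - t) *\<^sub>R h" and ?z = "x - t *\<^sub>R h"
      have each: "t * p k ?y + (1 - t) * p k ?z \<le> p k x + 2 * C * e' * R * (1 / 2) ^ k" for k
      proof -
        have "(1 / 4) ^ k * (t * soft (s k) (N ?y) + (1 - t) * soft (s k) (N ?z)) 
            \<le> (1 / 4) ^ k * soft (s k) (N x) + e' * R * (1 / 2) ^ k"
        proof (cases "k < m")
          case True
          have "(1 / 4) ^ k * (t * soft (s k) (N ?y) + (1 - t) * soft (s k) (N ?z)) 
             \<le> (1 / 4) ^ k * (soft (s k) (N x) + e' * R)"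
            using D(2)[of h k t x] h \<delta>(2)[OF True] t by (intro mult_left_mono) (auto simp: R_def mult_ac)
          also have "\<dots> \<le> (1 / 4) ^ k * soft (s k) (N x) + e' * R * (1 / 2) ^ k"
            using pow[of k] e' R mult_left_mono[OF pow[of k], of "e' * R"] by (simp add: algebra_simps)
          finally show ?thesis .
        next
          case False
          have Nh: "2 * t * (1 - t) * N h \<le> 2 * b * R"
            using mult_left_mono[OF ab(4)[of h], of "2 * t * (1 - t)"] t by (simp add: R_def mult_ac)
          have "soft (s k) (N ?y) \<le> soft (s k) (N x) + (1 - t) * N h"
            using soft_norm_lipschitz[OF N(1) s[of k], of x "(1 - t) *\<^sub>R h"] t by (simp add: n(3))
          moreover have "soft (s k) (N ?z) \<le> soft (s k) (N x) + t * N h"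
            using soft_norm_lipschitz[OF N(1) s[of k], of x "(- t) *\<^sub>R h"] t by (simp add: n(3) n(5))
          ultimately have "t * soft (s k) (N ?y) + (1 - t) * soft (s k) (N ?z)
             \<le> t * (soft (s k) (N x) + (1 - t) * N h) + (1 - t) * (soft (s k) (N x) + t * N h)"
            using t by (intro add_mono mult_left_mono) auto
          also have "\<dots> = soft (s k) (N x) + 2 * t * (1 - t) * N h" by (simp add: algebra_simps)
          also have "\<dots> \<le> soft (s k) (N x) + 2 * b * R" using Nh by simp
          finally have "(1 / 4) ^ k * (t * soft (s k) (N ?y) + (1 - t) * soft (s k) (N ?z))
             \<le> (1 / 4) ^ k * (soft (s k) (N x) + 2 * b * R)" by (intro mult_left_mono) auto
          moreover have "(1 / 4) ^ k * (2 * b * R) \<le> e' * R * (1 / 2) ^ k"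
          proof -
            have "(1 / 2 :: real) ^ k \<le> (1 / 2) ^ m" using False by (intro power_decreasing) auto
            then have "2 * b * (1 / 2) ^ k \<le> 2 * b * (1 / 2) ^ m" using ab by (intro mult_left_mono) auto
            also have "\<dots> \<le> e'" using m by (simp add: power_divide)
            finally have "2 * b * (1 / 2) ^ k * (R * (1 / 2) ^ k) \<le> e' * (R * (1 / 2) ^ k)"
              using R by (intro mult_right_mono) auto
            moreover have "(1 / 4 :: real) ^ k = (1 / 2) ^ k * (1 / 2) ^ k"
              by (simp flip: power_mult_distrib)
            ultimately show ?thesis by (simp add: mult_ac)
          qed
          ultimately show ?thesis by (simp add: algebra_simps)
        qed
        then have "C * ((1 / 4) ^ k * (t * soft (s k) (N ?y) + (1 - t) * soft (s k) (N ?z)))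
            \<le> C * ((1 / 4) ^ k * soft (s k) (N x) + e' * R * (1 / 2) ^ k)"
          using C by (intro mult_left_mono) auto
        moreover have "0 \<le> C * (e' * R * (1 / 2) ^ k)" using C e' R by simp
        ultimately show ?thesis by (simp add: p_def algebra_simps)
      qed
      have "t * \<Phi> ?y + (1 - t) * \<Phi> ?z = (\<Sum>k. t * p k ?y + (1 - t) * p k ?z)"
        unfolding \<Phi>_def
        by (simp only: suminf_mult[OF sump, symmetric] suminf_add[OF summable_mult[OF sump] summable_mult[OF sump]])
      also have "\<dots> \<le> (\<Sum>k. p k x + 2 * C * e' * R * (1 / 2) ^ k)"
        by (intro suminf_le each summable_add summable_mult sump geo)
      also have "\<dots> = \<Phi> x + 2 * C * e' * R * 2"
        unfolding \<Phi>_def by (simp only: suminf_add[OF sump sumN, symmetric] suminf_mult[OF geo(1)] geo(2))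
      also have "\<dots> = \<Phi> x + e * t * (1 - t) * norm h" using C by (simp add: e'_def R_def)
      finally show ?thesis .
    qed
    with \<delta>(1) show ?thesis by blast
  qed
  then obtain d where d: "\<And>e. 0 < e \<Longrightarrow> 0 < d e"
    "\<And>e x h t. 0 < e \<Longrightarrow> norm h \<le> d e \<Longrightarrow> 0 \<le> t \<Longrightarrow> t \<le> 1 \<Longrightarrow>
      t * \<Phi> (x + (1 - t) *\<^sub>R h) + (1 - t) * \<Phi> (x - t *\<^sub>R h) \<le> \<Phi> x + e * t * (1 - t) * norm h"
    by metis
  show thesis
  proof (rule that[of d \<Phi> "2 * C * b"])
    show "0 < d e" if "0 < e" for e using d(1) that .
    show "semiconvex d (\<lambda>x. - \<Phi> x)"
      unfolding semiconvex_def
    proof (intro allI impI ballI)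
      fix e :: real and x h :: 'a and t :: real
      assume "0 < e" "t \<in> {0..1}" "norm h \<le> d e"
      then show "- \<Phi> x \<le> t * - \<Phi> (x + (1 - t) *\<^sub>R h) + (1 - t) * - \<Phi> (x - t *\<^sub>R h) + e * t * (1 - t) * norm h"
        using d(2)[of e h t x] by simp
    qed
    show "\<Phi> 0 = 0" using n(2)[of 0] by (simp add: \<Phi>_def p_def)
    show "0 \<le> \<Phi> u" for u unfolding \<Phi>_def by (intro suminf_nonneg sump p0)
    show "0 \<le> 2 * C * b" using C ab by simp
    show "\<Phi> u \<le> 2 * C * b * norm u" for u
    proof -
      have "\<Phi> u \<le> (\<Sum>k. C * N u * (1 / 2) ^ k)"
        unfolding \<Phi>_def by (intro suminf_le pN sump sumN)
      also have "\<dots> = C * N u * 2" using geo by (simp only: suminf_mult)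
      also have "\<dots> \<le> C * (b * norm u) * 2" using C ab by (intro mult_mono) (auto simp: n(1))
      finally show ?thesis by (simp add: mult_ac)
    qed
    show "K * (1 / 4) ^ k * norm u \<le> \<Phi> u" if "r k \<le> norm u" for k u
    proof -
      have "s k \<le> a * norm u" using that ab by (simp add: s_def)
      then have "s k \<le> N u" using ab(3)[of u] by simp
      from soft_ge_half[OF s this] have "a * norm u / 2 \<le> soft (s k) (N u)" using ab(3)[of u] by simp
      then have "C * (1 / 4) ^ k * (a * norm u / 2) \<le> p k u"
        unfolding p_def using C by (intro mult_left_mono) auto
      also have "\<dots> \<le> \<Phi> u"
        unfolding \<Phi>_def using sum_le_suminf[OF sump, of "{k}" u] p0 by simp
      finally show ?thesis using ab by (simp add: C_def)
    qed
  qed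
qed

section \<open>Extension of jets that are uniform on their domain\<close>

text \<open>
Applied to \<open>- \<Phi>\<close>, this covers the lower cones and the negatives of the upper cones alike.
\<close>

lemma semiconvex_add_affine:
  assumes g: "semiconvex d g"
  shows "semiconvex d (\<lambda>x. c + blinfun_apply A (x - y) + g (x - y))"
  unfolding semiconvex_def
proof (intro allI impI ballI)
  fix e :: real and x h :: 'a and t :: real
  assume *: "0 < e" "t \<in> {0..1}" "norm h \<le> d e"
  have 1: "x + (1 - t) *\<^sub>R h - y = x - y + (1 - t) *\<^sub>R h" "x - t *\<^sub>R h - y = x - y - t *\<^sub>R h"
    by simp_all
  have "g (x - y) \<le> t * g (x - y + (1 - t) *\<^sub>R h) + (1 - t) * g (x - y - t *\<^sub>R h) + e * t * (1 - t) * norm h"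
    using semiconvexD[OF g, of e t h "x - y"] * by simp
  then show "c + A (x - y) + g (x - y)
      \<le> t * (c + A (x + (1 - t) *\<^sub>R h - y) + g (x + (1 - t) *\<^sub>R h - y)) +
        (1 - t) * (c + A (x - t *\<^sub>R h - y) + g (x - t *\<^sub>R h - y)) + e * t * (1 - t) * norm h"
    unfolding 1 by (simp add: blinfun.add_right blinfun.diff_right blinfun.scaleR_right algebra_simps)
qed

definition jet_close :: "('a::real_normed_vector \<Rightarrow> real) \<Rightarrow> ('a \<Rightarrow> ('a \<Rightarrow>\<^sub>L real)) \<Rightarrow> real \<Rightarrow> 'a \<Rightarrow> 'a \<Rightarrow> bool" where
  "jet_close f G e z y \<longleftrightarrow>
     \<bar>f y - f z - blinfun_apply (G z) (y - z)\<bar> \<le> e * norm (y - z) \<and> norm (G y - G z) \<le> e"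

lemma jet_close_near:
  assumes jet: "jet_on E f G" and e: "0 < e"
  obtains r where "0 < r" "\<And>y z. y \<in> E \<Longrightarrow> z \<in> E \<Longrightarrow> norm (y - z) < r \<Longrightarrow> jet_close f G e z y"
proof -
  obtain r1 where r1: "0 < r1" "\<forall>x\<in>E. \<forall>y\<in>E. norm (y - x) < r1 \<longrightarrow>
        \<bar>f y - f x - blinfun_apply (G x) (y - x)\<bar> \<le> e * norm (y - x)"
    using jet_onD(4)[OF jet e] by blast
  obtain r2 where r2: "0 < r2" "\<forall>x\<in>E. \<forall>x'\<in>E. dist x' x < r2 \<longrightarrow> dist (G x') (G x) < e"
    using jet_onD(3)[OF jet, unfolded uniformly_continuous_on_def, THEN spec[of _ e], THEN mp, OF e] by blast
  show thesis
  proof (rule that[of "min r1 r2"])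
    show "0 < min r1 r2" using r1(1) r2(1) by simp
    show "jet_close f G e z y" if "y \<in> E" "z \<in> E" "norm (y - z) < min r1 r2" for y z
      using r1(2)[rule_format, OF that(2,1)] r2(2)[rule_format, OF that(2,1)] that(3)
      by (simp add: jet_close_def dist_norm)
  qed
qed

text \<open>
For points at distance at least \<open>r\<close> the bounds on \<open>f\<close> and \<open>G\<close> suffice, since
\<open>2 A \<le> (2 A / r) \<parallel>y - z\<parallel>\<close>.
\<close>

lemma jet_close_global:
  assumes jet: "jet_on E f G"
  obtains K where "0 < K" "\<And>y z. y \<in> E \<Longrightarrow> z \<in> E \<Longrightarrow> jet_close f G K z y"
proof -
  obtain r where r: "0 < r" "\<And>y z. y \<in> E \<Longrightarrow> z \<in> E \<Longrightarrow> norm (y - z) < r \<Longrightarrow> jet_close f G 1 z y"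
    using jet_close_near[OF jet zero_less_one] by blast
  obtain A where A: "\<forall>y\<in>f ` E. norm y \<le> A" using jet_onD(1)[OF jet] unfolding bounded_iff by blast
  obtain B where B: "\<forall>y\<in>G ` E. norm y \<le> B" using jet_onD(2)[OF jet] unfolding bounded_iff by blast
  define K where "K = 1 + 2 * \<bar>A\<bar> / r + 2 * \<bar>B\<bar>"
  have K: "1 \<le> K" using r(1) by (simp add: K_def)
  have "jet_close f G K z y" if yz: "y \<in> E" "z \<in> E" for y z
  proof -
    have f: "\<bar>f y\<bar> \<le> \<bar>A\<bar>" "\<bar>f z\<bar> \<le> \<bar>A\<bar>" using A yz by auto
    have g: "norm (G y) \<le> \<bar>B\<bar>" "norm (G z) \<le> \<bar>B\<bar>" using B yz by auto
    have "norm (G y - G z) \<le> 2 * \<bar>B\<bar>" using norm_triangle_ineq4[of "G y" "G z"] g by simp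
    also have "\<dots> \<le> K" using r(1) by (simp add: K_def)
    finally have 1: "norm (G y - G z) \<le> K" .
    have "\<bar>f y - f z - G z (y - z)\<bar> \<le> K * norm (y - z)"
    proof (cases "norm (y - z) < r")
      case True
      then have "\<bar>f y - f z - G z (y - z)\<bar> \<le> 1 * norm (y - z)"
        using r(2)[OF yz] by (simp add: jet_close_def)
      also have "\<dots> \<le> K * norm (y - z)" using K by (intro mult_right_mono) auto
      finally show ?thesis .
    next
      case False
      have "\<bar>G z (y - z)\<bar> \<le> norm (G z) * norm (y - z)" using norm_blinfun[of "G z" "y - z"] by simp
      also have "\<dots> \<le> \<bar>B\<bar> * norm (y - z)" using g by (intro mult_right_mono) auto
      finally have 2: "\<bar>G z (y - z)\<bar> \<le> \<bar>B\<bar> * norm (y - z)" .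
      have "2 * \<bar>A\<bar> / r * r \<le> 2 * \<bar>A\<bar> / r * norm (y - z)"
        using False r(1) by (intro mult_left_mono) auto
      then have 3: "2 * \<bar>A\<bar> \<le> 2 * \<bar>A\<bar> / r * norm (y - z)" using r(1) by simp
      have "\<bar>f y - f z - G z (y - z)\<bar> \<le> (2 * \<bar>A\<bar> / r + \<bar>B\<bar>) * norm (y - z)"
        using f 2 3 unfolding distrib_right by linarith
      also have "\<dots> \<le> K * norm (y - z)" by (intro mult_right_mono) (auto simp: K_def)
      finally show ?thesis .
    qed
    with 1 show ?thesis by (simp add: jet_close_def)
  qed
  with K show thesis by (intro that[of K]) auto
qed

text \<open>
For points at distance \<open>s\<close>, level \<open>k\<close> is the right one: the error bound valid below the scale
\<open>r k\<close> applies, and a kernel that dominates it from the next scale \<open>r (Suc k)\<close> on is large enough.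
\<close>

lemma dyadic_scale:
  fixes r :: "nat \<Rightarrow> real"
  assumes r: "\<And>k. r k \<le> (1 / 2) ^ k" and s: "0 < s"
  obtains k where "r (Suc k) \<le> s" "k = 0 \<or> s < r k"
proof -
  have "(\<lambda>k. 1 / 2 ^ k) \<longlonglongrightarrow> (0::real)" by (rule LIMSEQ_divide_realpow_zero) simp
  then obtain m where "1 / 2 ^ m < s"
    using order_tendstoD(2)[OF _ s] eventually_sequentially by (metis (no_types, lifting) order_refl)
  moreover have "(1 / 2) ^ Suc m \<le> (1 / 2 :: real) ^ m" by (intro power_decreasing) auto
  ultimately have ex: "r (Suc m) \<le> s" using r[of "Suc m"] by (simp add: power_divide)
  define k where "k = (LEAST k. r (Suc k) \<le> s)"
  have "r (Suc k) \<le> s" unfolding k_def using ex by (rule LeastI)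
  moreover have "k = 0 \<or> s < r k"
  proof (cases k)
    case (Suc j)
    then have "\<not> r (Suc j) \<le> s" unfolding k_def by (intro not_less_Least) (auto simp: k_def)
    then show ?thesis using Suc by simp
  qed simp
  ultimately show thesis by (rule that)
qed

text \<open>
The affine parts of the two cones differ at \<open>x\<close> by the Taylor remainder between \<open>z\<close> and \<open>y\<close>, at most
\<open>2 e m\<close>, and by the change of the derivative applied to \<open>x - y\<close>, at most \<open>e m\<close>.
\<close>

lemma cone_inequality:
  assumes c: "jet_close f G e z y"
    and m: "norm (x - y) \<le> m" "norm (x - z) \<le> m"
  shows "f y + blinfun_apply (G y) (x - y) - (f z + blinfun_apply (G z) (x - z)) \<le> 3 * e * m"
proof -
  have e: "0 \<le> e" using c norm_ge_zero[of "G y - G z"] unfolding jet_close_def by linarith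
  have "norm (y - z) \<le> norm (x - z) + norm (x - y)"
    using norm_triangle_ineq4[of "x - z" "x - y"] by simp
  then have yz: "norm (y - z) \<le> 2 * m" using m by simp
  have "f y - f z - G z (y - z) \<le> e * (2 * m)"
    using c mult_left_mono[OF yz e] unfolding jet_close_def by linarith
  moreover have "(G y - G z) (x - y) \<le> e * m"
  proof -
    have "(G y - G z) (x - y) \<le> norm (G y - G z) * norm (x - y)"
      using norm_blinfun[of "G y - G z" "x - y"] by simp
    also have "\<dots> \<le> e * m" using c m e by (intro mult_mono) (auto simp: jet_close_def)
    finally show ?thesis .
  qed
  moreover have "f y + G y (x - y) - (f z + G z (x - z)) = (f y - f z - G z (y - z)) + (G y - G z) (x - y)"
    by (simp add: blinfun.diff_left blinfun.diff_right)
  ultimately show ?thesis by (simp add: algebra_simps)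
qed

text \<open>
The errors of the jet are bounded by \<open>K / 4 ^ k\<close> at scale \<open>r k\<close>, with the factor \<open>1 / 4\<close> demanded by
\<open>smooth_kernel\<close>. The kernel is chosen to dominate them; \<open>F\<close> is then inserted between the resulting cones.
\<close>

theorem extension_of_jet:
  fixes f :: "'a::real_normed_vector \<Rightarrow> real"
  assumes N: "equivalent_norm N" "uniformly_smooth_norm (N :: 'a \<Rightarrow> real)" and jet: "jet_on E f G"
  shows "\<exists>F\<in>C1plusB UNIV. \<forall>x\<in>E. F x = f x \<and> DF F x = G x"
proof (cases "E = {}")
  case True
  have "(\<lambda>x::'a. 0::real) \<in> C1plusB UNIV"
    by (rule C1plusB_of_uniform_expansion(1)[where d = "\<lambda>e. 1" and L = "\<lambda>x. 0"]) auto
  then show ?thesis using True by blast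
next
  case False
  then obtain y0 where y0: "y0 \<in> E" by blast
  obtain K where K: "0 < K" "\<And>y z. y \<in> E \<Longrightarrow> z \<in> E \<Longrightarrow> jet_close f G K z y"
    by (rule jet_close_global[OF jet]) blast
  have "\<exists>r>0. \<forall>y\<in>E. \<forall>z\<in>E. norm (y - z) < r \<longrightarrow> jet_close f G (K * (1 / 4) ^ k) z y" for k
    by (rule jet_close_near[OF jet, of "K * (1 / 4) ^ k"]) (use K(1) in auto)
  then obtain \<rho> where \<rho>: "\<And>k. 0 < \<rho> k"
    "\<And>k y z. y \<in> E \<Longrightarrow> z \<in> E \<Longrightarrow> norm (y - z) < \<rho> k \<Longrightarrow> jet_close f G (K * (1 / 4) ^ k) z y"
    by metis
  define r where "r = (\<lambda>k. min (\<rho> k) ((1 / 2) ^ k))"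
  have r: "0 < r k" "r k \<le> \<rho> k" "r k \<le> (1 / 2) ^ k" for k using \<rho>(1) by (auto simp: r_def)
  obtain \<Phi> :: "'a \<Rightarrow> real" and d M where
    d: "\<And>e. 0 < e \<Longrightarrow> 0 < d e" and sc: "semiconvex d (\<lambda>x. - \<Phi> x)"
    and \<Phi>: "\<Phi> 0 = 0" "\<And>u. 0 \<le> \<Phi> u" and M: "0 \<le> M" "\<And>u. \<Phi> u \<le> M * norm u"
    and dom: "\<And>k u. r (Suc k) / 2 \<le> norm u \<Longrightarrow> 3 * K * (1 / 4) ^ k * norm u \<le> \<Phi> u"
    by (rule smooth_kernel[OF N, of "\<lambda>k. r (Suc k) / 2" "3 * K"]) (use r(1) K(1) in auto)
  define l where "l = (\<lambda>y x. f y + G y (x - y))"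
  define u where "u = (\<lambda>y x. l y x - \<Phi> (x - y))"
  define v where "v = (\<lambda>y x. l y x + \<Phi> (x - y))"
  have uv: "u y x \<le> v z x" if yz: "y \<in> E" "z \<in> E" for y z x
  proof (cases "y = z")
    case True
    then show ?thesis using \<Phi>(2)[of "x - z"] by (simp add: u_def v_def)
  next
    case False
    then have "0 < norm (y - z)" by simp
    then obtain k where k: "r (Suc k) \<le> norm (y - z)" "k = 0 \<or> norm (y - z) < r k"
      by (rule dyadic_scale[of r, OF r(3)])
    have c: "jet_close f G (K * (1 / 4) ^ k) z y"
      using k(2)
    proof
      assume "k = 0" then show ?thesis using K(2)[OF yz] by simp
    next
      assume "norm (y - z) < r k" then show ?thesis using \<rho>(2)[OF yz] r(2)[of k] by simp
    qed
    \<comment> \<open>the longer of the two distances is at least half of the distance of y and z, so the kernel dominates there\<close>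
    obtain w where w: "w = x - y \<or> w = x - z" "norm (x - y) \<le> norm w" "norm (x - z) \<le> norm w"
      by (cases "norm (x - y) \<le> norm (x - z)") auto
    have "norm (y - z) \<le> norm (x - z) + norm (x - y)"
      using norm_triangle_ineq4[of "x - z" "x - y"] by simp
    then have "r (Suc k) / 2 \<le> norm w" using k(1) w(2,3) by simp
    from dom[OF this] have "3 * (K * (1 / 4) ^ k) * norm w \<le> \<Phi> w" by (simp add: mult_ac)
    also have "\<dots> \<le> \<Phi> (x - y) + \<Phi> (x - z)" using w(1) \<Phi>(2)[of "x - y"] \<Phi>(2)[of "x - z"] by auto
    finally show ?thesis
      using cone_inequality[OF c w(2,3)] by (simp add: u_def v_def l_def)
  qed
  have su: "semiconvex d (u y)" for y
    using semiconvex_add_affine[OF sc, of "f y" "G y" y] by (simp add: u_def l_def[abs_def])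
  have sv: "semiconvex d (\<lambda>x. - v y x)" for y
    using semiconvex_add_affine[OF sc, of "- f y" "- G y" y] by (simp add: v_def l_def blinfun.minus_left)
  obtain F where F: "semiconvex d F" "semiconvex d (\<lambda>x. - F x)"
    and uF: "\<And>a x. a \<in> u ` E \<Longrightarrow> a x \<le> F x" and Fv: "\<And>b x. b \<in> v ` E \<Longrightarrow> F x \<le> b x"
    by (rule semiconvex_semiconcave_insertion[of "u ` E" "v ` E" d]) (use y0 su sv uv in auto)
  have near: "\<bar>F x - f y - G y (x - y)\<bar> \<le> \<Phi> (x - y)" if "y \<in> E" for x y
    using uF[of "u y" x] Fv[of "v y" x] that by (simp add: u_def v_def l_def abs_le_iff)
  have bd: "bounded (F ` cball 0 R)" for R
  proof (rule boundedI)
    fix q assume "q \<in> F ` cball 0 R"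
    then obtain x where x: "q = F x" "norm x \<le> R" by auto
    have xy: "norm (x - y0) \<le> R + norm y0" using norm_triangle_ineq4[of x y0] x by simp
    have "\<bar>G y0 (x - y0)\<bar> \<le> norm (G y0) * norm (x - y0)"
      using norm_blinfun[of "G y0" "x - y0"] by simp
    moreover have "norm (G y0) * norm (x - y0) \<le> norm (G y0) * (R + norm y0)"
      "M * norm (x - y0) \<le> M * (R + norm y0)"
      using xy M(1) by (auto intro: mult_left_mono)
    ultimately show "norm q \<le> \<bar>f y0\<bar> + norm (G y0) * (R + norm y0) + M * (R + norm y0)"
      using near[OF y0, of x] M(2)[of "x - y0"] x(1) unfolding real_norm_def by linarith
  qed
  obtain L :: "'a \<Rightarrow> ('a \<Rightarrow>\<^sub>L real)" where L: "\<forall>e>0. \<forall>x h. norm h \<le> d e \<longrightarrow> \<bar>F (x + h) - F x - L x h\<bar> \<le> e * norm h"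
    using uniform_expansion_of_semiconvex[OF d F bd] by blast
  have Ff: "F y = f y" if "y \<in> E" for y
    using near[OF that, of y] \<Phi>(1) by simp
  have \<Phi>_small: "\<Phi> h \<le> e * norm h" if "0 < e" "norm h \<le> d e / 2" for e h
    using semiconvexD[OF sc that(1), of "1/2" "2 *\<^sub>R h" 0] that(2) \<Phi>(1) \<Phi>(2)[of "- h"] by simp
  have "DF F y = G y" if y: "y \<in> E" for y
  proof (rule DF_eqI, unfold has_derivative_at_alt, intro conjI allI impI)
    show "bounded_linear (blinfun_apply (G y))" by (rule blinfun.bounded_linear_right)
    fix e :: real assume e: "0 < e"
    have "norm (F x - F y - G y (x - y)) \<le> e * norm (x - y)" if "norm (x - y) < d e / 2" for x
      using near[OF y, of x] \<Phi>_small[OF e, of "x - y"] that Ff[OF y] by simp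
    then show "\<exists>c>0. \<forall>x. norm (x - y) < c \<longrightarrow> norm (F x - F y - G y (x - y)) \<le> e * norm (x - y)"
      using d[OF e] by (intro exI[of _ "d e / 2"]) auto
  qed
  moreover have "F \<in> C1plusB UNIV"
    by (rule C1plusB_of_uniform_expansion(1)[OF d L[rule_format]])
  ultimately show ?thesis using Ff by blast
qed

section \<open>Exhaustion by balls\<close>

text \<open>
Pairs of points at distance less than 1 either both lie within distance 1 of \<open>C\<close>, where the new jet is that of
\<open>F\<close>, or both lie in \<open>D\<close>, where it is \<open>(f, G)\<close>. All uniform estimates concern close pairs, so
they are inherited from the two jets.
\<close>

lemma jet_on_glue:
  assumes F: "F \<in> C1plusB UNIV" and C: "bounded C" and D: "jet_on D f G"
    and agree: "\<And>x. x \<in> D \<Longrightarrow> (\<exists>y\<in>C. dist y x < 1) \<Longrightarrow> F x = f x \<and> DF F x = G x"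
  shows "jet_on (C \<union> D) (\<lambda>x. if x \<in> C then F x else f x) (\<lambda>x. if x \<in> C then DF F x else G x)"
    (is "jet_on _ ?f ?G")
proof -
  define B where "B = (\<Union>y\<in>C. ball y 1)"
  have CB: "C \<subseteq> B" by (force simp: B_def)
  have "bounded B"
  proof -
    obtain R where R: "\<forall>y\<in>C. norm y \<le> R" using C unfolding bounded_iff by blast
    show ?thesis
    proof (rule boundedI)
      fix x assume "x \<in> B"
      then obtain y where y: "y \<in> C" "norm (y - x) < 1" by (auto simp: B_def dist_norm)
      then show "norm x \<le> R + 1" using R[rule_format, OF y(1)] norm_triangle_ineq4[of y "y - x"] by simp
    qed
  qed
  then have jB: "jet_on B F (DF F)"
    using condition_W_of_C1plusB[OF F] unfolding condition_W_iff_jet_on by blast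
  have eqB: "?f x = F x \<and> ?G x = DF F x" if "x \<in> C \<union> D" "x \<in> B" for x
    using that agree[of x] by (auto simp: B_def)
  have eqD: "?f x = f x \<and> ?G x = G x" if "x \<in> D" for x
    using that agree[of x] by force
  have pair: "(x \<in> B \<and> y \<in> B) \<or> (x \<in> D \<and> y \<in> D)" if "x \<in> C \<union> D" "y \<in> C \<union> D" "dist x y < 1" for x y
  proof (cases "x \<in> C \<or> y \<in> C")
    case True
    then have "x \<in> B \<and> y \<in> B"
    proof
      assume "x \<in> C"
      then show ?thesis using CB that(3) unfolding B_def by (auto intro!: bexI[of _ x])
    next
      assume "y \<in> C"
      then show ?thesis using CB that(3) unfolding B_def by (auto intro!: bexI[of _ y] simp: dist_commute)
    qed
    then show ?thesis ..
  qed (use that in auto)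
  show ?thesis
    unfolding jet_on_def
  proof (intro conjI allI impI)
    have "?f ` (C \<union> D) \<subseteq> F ` B \<union> f ` D" "?G ` (C \<union> D) \<subseteq> DF F ` B \<union> G ` D" using CB by auto
    then show "bounded (?f ` (C \<union> D))" "bounded (?G ` (C \<union> D))"
      using jet_onD(1,2)[OF jB] jet_onD(1,2)[OF D] by (meson bounded_Un bounded_subset)+
    show "uniformly_continuous_on (C \<union> D) ?G"
      unfolding uniformly_continuous_on_def
    proof (intro allI impI)
      fix e :: real assume e: "0 < e"
      obtain r1 where r1: "0 < r1" "\<forall>x\<in>B. \<forall>y\<in>B. dist y x < r1 \<longrightarrow> dist (DF F y) (DF F x) < e"
        using jet_onD(3)[OF jB, unfolded uniformly_continuous_on_def, THEN spec[of _ e], THEN mp, OF e] by blast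
      obtain r2 where r2: "0 < r2" "\<forall>x\<in>D. \<forall>y\<in>D. dist y x < r2 \<longrightarrow> dist (G y) (G x) < e"
        using jet_onD(3)[OF D, unfolded uniformly_continuous_on_def, THEN spec[of _ e], THEN mp, OF e] by blast
      have "dist (?G y) (?G x) < e" if xy: "x \<in> C \<union> D" "y \<in> C \<union> D" "dist y x < min 1 (min r1 r2)" for x y
      proof -
        have "dist x y < 1" using xy(3) by (simp add: dist_commute)
        from pair[OF xy(1,2) this] show ?thesis
        proof
          assume "x \<in> B \<and> y \<in> B"
          then show ?thesis using eqB[OF xy(1)] eqB[OF xy(2)] r1(2) xy(3) by auto
        next
          assume "x \<in> D \<and> y \<in> D"
          then show ?thesis using eqD[of x] eqD[of y] r2(2) xy(3) by auto
        qed
      qed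
      then show "\<exists>d>0. \<forall>x\<in>C \<union> D. \<forall>y\<in>C \<union> D. dist y x < d \<longrightarrow> dist (?G y) (?G x) < e"
        using r1(1) r2(1) by (intro exI[of _ "min 1 (min r1 r2)"] conjI ballI impI) auto
    qed
    fix e :: real assume e: "0 < e"
    obtain r1 where r1: "0 < r1" "\<forall>x\<in>B. \<forall>y\<in>B. norm (y - x) < r1 \<longrightarrow>
        \<bar>F y - F x - blinfun_apply (DF F x) (y - x)\<bar> \<le> e * norm (y - x)"
      using jet_onD(4)[OF jB e] by blast
    obtain r2 where r2: "0 < r2" "\<forall>x\<in>D. \<forall>y\<in>D. norm (y - x) < r2 \<longrightarrow>
        \<bar>f y - f x - blinfun_apply (G x) (y - x)\<bar> \<le> e * norm (y - x)"
      using jet_onD(4)[OF D e] by blast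
    have "\<bar>?f y - ?f x - blinfun_apply (?G x) (y - x)\<bar> \<le> e * norm (y - x)"
      if xy: "x \<in> C \<union> D" "y \<in> C \<union> D" "norm (y - x) < min 1 (min r1 r2)" for x y
    proof -
      have "dist x y < 1" using xy(3) by (simp add: dist_norm norm_minus_commute)
      from pair[OF xy(1,2) this] show ?thesis
      proof
        assume "x \<in> B \<and> y \<in> B"
        then show ?thesis using eqB[OF xy(1)] eqB[OF xy(2)] r1(2) xy(3) by auto
      next
        assume "x \<in> D \<and> y \<in> D"
        then show ?thesis using eqD[of x] eqD[of y] r2(2) xy(3) by auto
      qed
    qed
    then show "\<exists>\<delta>>0. \<forall>x\<in>C \<union> D. \<forall>y\<in>C \<union> D. norm (y - x) < \<delta> \<longrightarrow>
        \<bar>?f y - ?f x - blinfun_apply (?G x) (y - x)\<bar> \<le> e * norm (y - x)"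
      using r1(1) r2(1) by (intro exI[of _ "min 1 (min r1 r2)"] conjI ballI impI) auto
  qed
qed

text \<open>
The radii leave room for pairs at distance less than 1: a point of \<open>E\<close> that close to \<open>cball 0 n\<close> lies in
\<open>cball 0 (n + 1)\<close>, where \<open>H\<close> carries the jet \<open>(f, G)\<close>.
\<close>

lemma extension_step:
  fixes f :: "'a::real_normed_vector \<Rightarrow> real"
  assumes N: "equivalent_norm N" "uniformly_smooth_norm (N :: 'a \<Rightarrow> real)" and W: "condition_W E f G"
    and H: "H \<in> C1plusB UNIV" "\<And>x. x \<in> E \<inter> cball 0 (real n + 1) \<Longrightarrow> H x = f x \<and> DF H x = G x"
  shows "\<exists>F\<in>C1plusB UNIV. (\<forall>x\<in>E \<inter> cball 0 (real (Suc n) + 1). F x = f x \<and> DF F x = G x) \<and>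
    (\<forall>x\<in>cball 0 (real n). F x = H x)"
proof -
  let ?C = "cball (0::'a) (real n)" and ?D = "E \<inter> cball 0 (real (Suc n) + 1)"
  have D: "jet_on ?D f G"
    using W unfolding condition_W_iff_jet_on by (simp add: bounded_Int)
  have agree: "H x = f x \<and> DF H x = G x" if xD: "x \<in> ?D" and xC: "\<exists>y\<in>?C. dist y x < 1" for x
  proof (rule H(2))
    obtain y where y: "norm y \<le> real n" "norm (y - x) < 1" using xC by (auto simp: dist_norm)
    then have "norm x \<le> real n + 1" using norm_triangle_ineq4[of y "y - x"] by simp
    then show "x \<in> E \<inter> cball 0 (real n + 1)" using xD by simp
  qed
  obtain F where F: "F \<in> C1plusB UNIV"
    "\<forall>x\<in>?C \<union> ?D. F x = (if x \<in> ?C then H x else f x) \<and> DF F x = (if x \<in> ?C then DF H x else G x)"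
    using extension_of_jet[OF N jet_on_glue[OF H(1) bounded_cball D agree]] by blast
  have "F x = f x \<and> DF F x = G x" if "x \<in> ?D" for x
  proof (cases "x \<in> ?C")
    case True
    then have "\<exists>y\<in>?C. dist y x < 1" by (intro bexI[of _ x]) auto
    from agree[OF that this] show ?thesis using F(2)[rule_format, of x] True by simp
  next
    case False
    then show ?thesis using F(2)[rule_format, of x] that by simp
  qed
  moreover have "F x = H x" if "x \<in> ?C" for x using F(2)[rule_format, of x] that by simp
  ultimately show ?thesis using F(1) by blast
qed

lemma C1plusB_of_local_agreement:
  fixes F :: "'a::real_normed_vector \<Rightarrow> real" and H :: "nat \<Rightarrow> 'a \<Rightarrow> real"
  assumes H: "\<And>n. H n \<in> C1plusB UNIV" and eq: "\<And>n x. norm x < real n \<Longrightarrow> F x = H n x"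
  shows "F \<in> C1plusB UNIV" "\<And>n x. norm x < real n \<Longrightarrow> DF F x = DF (H n) x"
proof -
  have der: "(F has_derivative blinfun_apply (DF (H n) x)) (at x)" if x: "norm x < real n" for n x
  proof (rule has_derivative_transform_within_open)
    show "(H n has_derivative blinfun_apply (DF (H n) x)) (at x)"
      using H[of n] by (intro has_derivative_DF) (simp add: C1plusB_def)
    show "open (ball (0::'a) (real n))" "x \<in> ball 0 (real n)" using x by auto
    show "H n y = F y" if "y \<in> ball 0 (real n)" for y using eq[of y n] that by simp
  qed
  then show DF: "DF F x = DF (H n) x" if "norm x < real n" for n x
    using that by (intro DF_eqI)
  show "F \<in> C1plusB UNIV"
    unfolding C1plusB_def
  proof (intro CollectI conjI ballI allI impI)
    fix x :: 'a
    obtain n where "norm x < real n" using reals_Archimedean2 by blast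
    from der[OF this] show "F differentiable (at x)" unfolding differentiable_def by blast
  next
    fix B :: "'a set" assume "bounded B"
    then obtain R where R: "\<forall>x\<in>B. norm x \<le> R" unfolding bounded_iff by blast
    obtain n where n: "R < real n" using reals_Archimedean2 by blast
    have eqB: "DF F x = DF (H n) x" if "x \<in> B" for x using R[rule_format, OF that] n by (intro DF) simp
    have "uniformly_continuous_on B (DF (H n))"
      using H[of n] \<open>bounded B\<close> by (simp add: C1plusB_def)
    then show "uniformly_continuous_on B (DF F)"
      unfolding uniformly_continuous_on_def by (simp add: eqB)
  qed
qed

lemma extension_of_condition_W:
  fixes f :: "'a::real_normed_vector \<Rightarrow> real"
  assumes N: "equivalent_norm N" "uniformly_smooth_norm (N :: 'a \<Rightarrow> real)" and W: "condition_W E f G"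
  shows "\<exists>F\<in>C1plusB UNIV. \<forall>x\<in>E. F x = f x \<and> DF F x = G x"
proof -
  define P where "P = (\<lambda>n H. H \<in> C1plusB UNIV \<and>
    (\<forall>x\<in>E \<inter> cball 0 (real n + 1). H x = f x \<and> DF H x = G x))"
  define Q where "Q = (\<lambda>n H H'. \<forall>x\<in>cball (0::'a) (real n). (H' x :: real) = H x)"
  have "jet_on (E \<inter> cball 0 (real 0 + 1)) f G"
    using W unfolding condition_W_iff_jet_on by (simp add: bounded_Int)
  then obtain H0 where "P 0 H0"
    unfolding P_def using extension_of_jet[OF N] by blast
  moreover have "\<exists>H'. P (Suc n) H' \<and> Q n H H'" if "P n H" for n H
    using extension_step[OF N W, of H n] that unfolding P_def Q_def by blast
  ultimately obtain H where H: "\<And>n. P n (H n)" "\<And>n. Q n (H n) (H (Suc n))"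
    using dependent_nat_choice[of P Q] by blast
  have stable: "H (n + k) x = H n x" if "norm x \<le> real n" for n k x
  proof (induction k)
    case (Suc k)
    have "H (Suc (n + k)) x = H (n + k) x"
      using H(2)[of "n + k"] that by (simp add: Q_def)
    with Suc show ?case by simp
  qed simp
  \<comment> \<open>any index at least the norm of x gives the same value\<close>
  define F where "F = (\<lambda>x. H (nat \<lceil>norm x\<rceil>) x)"
  have F: "F x = H n x" if "norm x < real n" for n x
  proof -
    have 1: "norm x \<le> real (nat \<lceil>norm x\<rceil>)" by linarith
    have "nat \<lceil>norm x\<rceil> \<le> n" using that by linarith
    then show ?thesis
      using stable[OF 1, of "n - nat \<lceil>norm x\<rceil>"] by (simp add: F_def)
  qed
  have HC: "H n \<in> C1plusB UNIV" for n using H(1)[of n] by (simp add: P_def)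
  have "F x = f x \<and> DF F x = G x" if x: "x \<in> E" for x
  proof -
    obtain n where n: "norm x < real n" using reals_Archimedean2 by blast
    then have "x \<in> E \<inter> cball 0 (real n + 1)" using x by simp
    then have "H n x = f x \<and> DF (H n) x = G x" using H(1)[of n] unfolding P_def by blast
    then show ?thesis using F[OF n] C1plusB_of_local_agreement(2)[of H F, OF HC F n] by simp
  qed
  then show ?thesis
    using C1plusB_of_local_agreement(1)[of H F, OF HC F] by blast
qed

theorem theorem4:
  fixes E :: "'a::banach set" and f :: "'a \<Rightarrow> real"
  assumes "super_reflexive TYPE('a)"
  shows "((\<exists>F\<in>C1plusB UNIV. \<forall>x\<in>E. F x = f x) \<longleftrightarrow> (\<exists>G. condition_W E f G)) \<and>
         (\<forall>G. condition_W E f G \<longrightarrow>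
            (\<exists>F\<in>C1plusB UNIV. (\<forall>x\<in>E. F x = f x) \<and> (\<forall>x\<in>E. DF F x = G x)))"
proof -
  obtain N :: "'a \<Rightarrow> real" where N: "equivalent_norm N" "uniformly_smooth_norm N"
    using assms unfolding super_reflexive_def by blast
  have ext: "\<exists>F\<in>C1plusB UNIV. (\<forall>x\<in>E. F x = f x) \<and> (\<forall>x\<in>E. DF F x = G x)"
    if "condition_W E f G" for G
    using extension_of_condition_W[OF N that] by blast
  have nec: "condition_W E f (DF F)" if F: "F \<in> C1plusB UNIV" and eq: "\<forall>x\<in>E. F x = f x" for F
    unfolding condition_W_iff_jet_on
  proof (intro allI impI)
    fix B assume B: "B \<subseteq> E" "bounded B"
    have jet: "jet_on B F (DF F)"
      using condition_W_of_C1plusB[OF F] B(2) unfolding condition_W_iff_jet_on by simp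
    have eqB: "F x = f x" if "x \<in> B" for x using eq B(1) that by blast
    then have im: "F ` B = f ` B" by (rule image_cong[OF refl])
    show "jet_on B f (DF F)"
      using jet unfolding jet_on_def im by (simp add: eqB)
  qed
  show ?thesis using ext nec by blast
qed

end
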